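(* The set $\mathcal{DO}$ of all doubling spaces, the set $\mathcal{UD}$ of all uniformly disconnected spaces, and the set $\mathcal{UP}$ of all uniformly perfect spaces in $\mathcal{M}$ are each dense, $F_{\sigma}$ and meager in the Gromov--Hausdorff space $(\mathcal{M}, d_{GH})$.
   Context: $\mathcal{M}$ is the set of all isometry classes of non-empty compact metric spaces, equipped with the Gromov--Hausdorff distance $d_{GH}$. $B(x,r)$ denotes the closed ball and $\delta_d(X)$ the diameter. A metric space $(X,d)$ is $N$-doubling ($N\in\mathbb{N}$) if for all $x\in X$, $r\in(0,\infty)$ there is $F\subset X$ with $B(x,r)\subset\bigcup_{y\in F}B(y,r/2)$ and $\mathrm{Card}(F)\le N$; it is doubling if it is $N$-doubling for some $N$. It is $\delta$-uniformly disconnected ($\delta\in(0,\infty)$) if for every non-constant finite sequence $\{z_i\}_{i=1}^N$ in $X$ we have $\delta d(z_1,z_N)\le\max_{1\le i\le N-1}d(z_i,z_{i+1})$; it is uniformly disconnected if this holds for some $\delta\in(0,\infty)$. It is $c$-uniformly perfect ($c\in(0,1)$) if for every $x\in X$ and every $r\in(0,\delta_d(X))$ there is $y\in X$ with $c\cdot r\le d(x,y)\le r$; it is uniformly perfect if this holds for some $c\in(0,1)$. A subset is $F_\sigma$ if it is a countable union of closed sets; it is meager if it is a countable union of nowhere dense sets. *)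

theory Defs
  imports "HOL-Analysis.Analysis"
begin

section \<open>Isometries and the Hausdorff distance\<close>

definition isometric_embedding :: "'a metric \<Rightarrow> 'b metric \<Rightarrow> ('a \<Rightarrow> 'b) \<Rightarrow> bool" where
  "isometric_embedding X Y f \<longleftrightarrow>
     f ` mspace X \<subseteq> mspace Y \<and>
     (\<forall>x\<in>mspace X. \<forall>y\<in>mspace X. mdist Y (f x) (f y) = mdist X x y)"

definition isometric :: "'a metric \<Rightarrow> 'b metric \<Rightarrow> bool" where
  "isometric X Y \<longleftrightarrow> (\<exists>f. isometric_embedding X Y f \<and> f ` mspace X = mspace Y)"

definition hausdorff_dist :: "'a metric \<Rightarrow> 'a set \<Rightarrow> 'a set \<Rightarrow> real" where
  "hausdorff_dist Z A B =
     max (SUP a\<in>A. INF b\<in>B. mdist Z a b) (SUP b\<in>B. INF a\<in>A. mdist Z a b)"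

lemma isometric_refl: "isometric X X"
  unfolding isometric_def isometric_embedding_def by (rule exI[of _ id]) auto

lemma isometric_embedding_comp:
  "isometric_embedding X Y f \<Longrightarrow> isometric_embedding Y Z g \<Longrightarrow> isometric_embedding X Z (g \<circ> f)"
  unfolding isometric_embedding_def by (auto simp: image_subset_iff)

lemma isometric_trans: "isometric X Y \<Longrightarrow> isometric Y Z \<Longrightarrow> isometric X Z"
  unfolding isometric_def by (metis (no_types, opaque_lifting) image_comp isometric_embedding_comp)

lemma isometric_embedding_inj: "isometric_embedding X Y f \<Longrightarrow> inj_on f (mspace X)"
  unfolding isometric_embedding_def inj_on_def
  by (metis Metric_space.zero Metric_space_mspace_mdist)

lemma isometricE_inverse:
  assumes "isometric X Y"
  obtains f g where "isometric_embedding X Y f" "isometric_embedding Y X g"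
    "f ` mspace X = mspace Y" "g ` mspace Y = mspace X"
    "\<And>x. x \<in> mspace X \<Longrightarrow> g (f x) = x" "\<And>y. y \<in> mspace Y \<Longrightarrow> f (g y) = y"
proof -
  obtain f where f: "isometric_embedding X Y f" "f ` mspace X = mspace Y"
    using assms unfolding isometric_def by blast
  define g where "g = inv_into (mspace X) f"
  have gf: "g (f x) = x" if "x \<in> mspace X" for x
    using that isometric_embedding_inj[OF f(1)] unfolding g_def by (rule inv_into_f_f[rotated])
  have fg: "f (g y) = y" if "y \<in> mspace Y" for y
    using that unfolding g_def f(2)[symmetric] by (rule f_inv_into_f)
  have gim: "g ` mspace Y = mspace X"
    unfolding f(2)[symmetric] image_image using gf by simp
  have "isometric_embedding Y X g"
    unfolding isometric_embedding_def
  proof (intro conjI ballI)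
    show "g ` mspace Y \<subseteq> mspace X" using gim by simp
    fix x y assume xy: "x \<in> mspace Y" "y \<in> mspace Y"
    then have "g x \<in> mspace X" "g y \<in> mspace X" using gim by auto
    then have "mdist Y (f (g x)) (f (g y)) = mdist X (g x) (g y)"
      using f(1) unfolding isometric_embedding_def by blast
    then show "mdist X (g x) (g y) = mdist Y x y"
      using fg xy by simp
  qed
  then show thesis using that[OF f(1) _ f(2) gim gf fg] by blast
qed

lemma isometric_sym: "isometric X Y \<Longrightarrow> isometric Y X"
  by (erule isometricE_inverse) (auto simp: isometric_def)


section \<open>The Gromov-Hausdorff space\<close>

text \<open>
  A compact metric space has at most continuum many points, so every isometry class of
  non-empty compact metric spaces has a representative whose points are real numbers;
  see \<open>compact_metric_has_real_copy\<close> below.  The metric on these points is arbitrary and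
  unrelated to the usual one.
\<close>

definition nonempty_compact_metric :: "'a metric \<Rightarrow> bool" where
  "nonempty_compact_metric X \<longleftrightarrow> mspace X \<noteq> {} \<and> compact_space (mtopology_of X)"

definition gh_rel :: "real metric \<Rightarrow> real metric \<Rightarrow> bool" where
  "gh_rel X Y \<longleftrightarrow> nonempty_compact_metric X \<and> nonempty_compact_metric Y \<and> isometric X Y"

lemma nonempty_compact_metric_unit: "nonempty_compact_metric (metric ({0::real}, dist))"
proof -
  interpret Metric_space "{0::real}" dist
    by (rule Met_TC.subspace) simp
  show ?thesis
    by (simp add: nonempty_compact_metric_def mtopology_of_def compact_space_def)
qed

quotient_type gh_space = "real metric" / partial: gh_rel
proof (rule part_equivpI)
  show "\<exists>X. gh_rel X X"
    using nonempty_compact_metric_unit isometric_refl unfolding gh_rel_def by blast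
  show "symp gh_rel"
    unfolding symp_def gh_rel_def by (blast intro: isometric_sym)
  show "transp gh_rel"
    unfolding transp_def gh_rel_def by (blast intro: isometric_trans)
qed

text \<open>
  The infimum is over all metric spaces \<open>Z\<close> containing isometric copies of both spaces.
  Again it is enough to let the points of \<open>Z\<close> be real numbers, because only the points in
  the two copies matter; see \<open>gromov_hausdorff_ambient_real\<close> below.
\<close>

definition gromov_hausdorff :: "real metric \<Rightarrow> real metric \<Rightarrow> real" where
  "gromov_hausdorff X Y =
     Inf {hausdorff_dist Z (f ` mspace X) (g ` mspace Y) | (Z :: real metric) f g.
            isometric_embedding X Z f \<and> isometric_embedding Y Z g}"

lemma hausdorff_copies_cong:
  assumes "isometric X X'" "isometric Y Y'"
    and "isometric_embedding X Z f" "isometric_embedding Y Z g"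
  shows "\<exists>f' g'. hausdorff_dist Z (f ` mspace X) (g ` mspace Y)
      = hausdorff_dist Z (f' ` mspace X') (g' ` mspace Y') \<and>
    isometric_embedding X' Z f' \<and> isometric_embedding Y' Z g'"
proof -
  obtain h where h: "isometric_embedding X' X h" "h ` mspace X' = mspace X"
    using isometric_sym[OF assms(1)] unfolding isometric_def by blast
  obtain k where k: "isometric_embedding Y' Y k" "k ` mspace Y' = mspace Y"
    using isometric_sym[OF assms(2)] unfolding isometric_def by blast
  have "(f \<circ> h) ` mspace X' = f ` mspace X" "(g \<circ> k) ` mspace Y' = g ` mspace Y"
    by (simp_all only: image_comp[symmetric] h(2) k(2))
  then show ?thesis
    using isometric_embedding_comp[OF h(1) assms(3)] isometric_embedding_comp[OF k(1) assms(4)]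
    by (intro exI[of _ "f \<circ> h"] exI[of _ "g \<circ> k"]) simp
qed

lift_definition gh_dist :: "gh_space \<Rightarrow> gh_space \<Rightarrow> real" is gromov_hausdorff
proof -
  fix X X' Y Y' assume "gh_rel X X'" "gh_rel Y Y'"
  then have XX: "isometric X X'" "isometric X' X" and YY: "isometric Y Y'" "isometric Y' Y"
    unfolding gh_rel_def by (blast intro: isometric_sym)+
  show "gromov_hausdorff X Y = gromov_hausdorff X' Y'"
    unfolding gromov_hausdorff_def
  proof (rule arg_cong[where f=Inf], rule Collect_cong, intro iffI; elim exE conjE)
    fix h and Z :: "real metric" and f g
    assume "h = hausdorff_dist Z (f ` mspace X) (g ` mspace Y)"
      "isometric_embedding X Z f" "isometric_embedding Y Z g"
    then show "\<exists>(Z :: real metric) f g. h = hausdorff_dist Z (f ` mspace X') (g ` mspace Y') \<and>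
        isometric_embedding X' Z f \<and> isometric_embedding Y' Z g"
      by (metis hausdorff_copies_cong[OF XX(1) YY(1)])
  next
    fix h and Z :: "real metric" and f g
    assume "h = hausdorff_dist Z (f ` mspace X') (g ` mspace Y')"
      "isometric_embedding X' Z f" "isometric_embedding Y' Z g"
    then show "\<exists>(Z :: real metric) f g. h = hausdorff_dist Z (f ` mspace X) (g ` mspace Y) \<and>
        isometric_embedding X Z f \<and> isometric_embedding Y Z g"
      by (metis hausdorff_copies_cong[OF XX(2) YY(2)])
  qed
qed

text \<open>
  The topology generated by the open \<open>gh_dist\<close>-balls.  The library constant is applied outside its
  locale: the sets containing a ball around each of their points form a topology whether or
  not the metric axioms have been established for \<open>gh_dist\<close>.
\<close>

definition gh_topology :: "gh_space topology" where
  "gh_topology = Metric_space.mtopology UNIV gh_dist"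


section \<open>Doubling, uniformly disconnected and uniformly perfect spaces\<close>

definition N_doubling :: "nat \<Rightarrow> 'a metric \<Rightarrow> bool" where
  "N_doubling N X \<longleftrightarrow>
     (\<forall>x\<in>mspace X. \<forall>r>0. \<exists>F\<subseteq>mspace X.
        mcball_of X x r \<subseteq> (\<Union>y\<in>F. mcball_of X y (r / 2)) \<and> finite F \<and> card F \<le> N)"

definition doubling :: "'a metric \<Rightarrow> bool" where
  "doubling X \<longleftrightarrow> (\<exists>N. N_doubling N X)"

text \<open>A non-constant sequence has length at least 2, so \<open>Max\<close> is taken over a non-empty set.\<close>

definition delta_uniformly_disconnected :: "real \<Rightarrow> 'a metric \<Rightarrow> bool" where
  "delta_uniformly_disconnected \<delta> X \<longleftrightarrow>
     (\<forall>(N::nat) z. (\<forall>i\<in>{1..N}. z i \<in> mspace X) \<longrightarrow>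
        (\<exists>i\<in>{1..N}. \<exists>j\<in>{1..N}. z i \<noteq> z j) \<longrightarrow>
        \<delta> * mdist X (z 1) (z N) \<le> Max ((\<lambda>i. mdist X (z i) (z (i + 1))) ` {1..N - 1}))"

definition uniformly_disconnected :: "'a metric \<Rightarrow> bool" where
  "uniformly_disconnected X \<longleftrightarrow> (\<exists>\<delta>>0. delta_uniformly_disconnected \<delta> X)"

definition mdiameter :: "'a metric \<Rightarrow> ereal" where
  "mdiameter X = (SUP x\<in>mspace X. SUP y\<in>mspace X. ereal (mdist X x y))"

definition c_uniformly_perfect :: "real \<Rightarrow> 'a metric \<Rightarrow> bool" where
  "c_uniformly_perfect c X \<longleftrightarrow>
     (\<forall>x\<in>mspace X. \<forall>r. 0 < r \<and> ereal r < mdiameter X \<longrightarrow>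
        (\<exists>y\<in>mspace X. c * r \<le> mdist X x y \<and> mdist X x y \<le> r))"

definition uniformly_perfect :: "'a metric \<Rightarrow> bool" where
  "uniformly_perfect X \<longleftrightarrow> (\<exists>c. 0 < c \<and> c < 1 \<and> c_uniformly_perfect c X)"

lemma N_doubling_isometric:
  assumes "isometric X Y" "N_doubling N X"
  shows "N_doubling N Y"
proof -
  obtain f g where f: "isometric_embedding X Y f" and g: "isometric_embedding Y X g"
    and im: "f ` mspace X = mspace Y" "g ` mspace Y = mspace X"
    and fg: "\<And>y. y \<in> mspace Y \<Longrightarrow> f (g y) = y"
    using isometricE_inverse[OF assms(1)] by metis
  show ?thesis
    unfolding N_doubling_def
  proof (intro ballI allI impI)
    fix x and r :: real assume x: "x \<in> mspace Y" and r: "0 < r"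
    have gx: "g x \<in> mspace X" using x im by auto
    then obtain F where F: "F \<subseteq> mspace X" "finite F" "card F \<le> N"
      and cov: "mcball_of X (g x) r \<subseteq> (\<Union>y\<in>F. mcball_of X y (r / 2))"
      using assms(2) r unfolding N_doubling_def by meson
    have "mcball_of Y x r \<subseteq> (\<Union>y\<in>f ` F. mcball_of Y y (r / 2))"
    proof
      fix u assume u: "u \<in> mcball_of Y x r"
      then have uY: "u \<in> mspace Y" by simp
      have "g u \<in> mcball_of X (g x) r"
        using u x gx g im unfolding isometric_embedding_def by auto
      then obtain y where y: "y \<in> F" "mdist X y (g u) \<le> r / 2" "y \<in> mspace X" "g u \<in> mspace X"
        using cov by fastforce
      then have "mdist Y (f y) (f (g u)) \<le> r / 2"
        using f unfolding isometric_embedding_def by auto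
      then have "u \<in> mcball_of Y (f y) (r / 2)"
        using y im fg uY by auto
      then show "u \<in> (\<Union>y\<in>f ` F. mcball_of Y y (r / 2))" using y by blast
    qed
    moreover have "card (f ` F) \<le> N" using F card_image_le le_trans by blast
    ultimately show "\<exists>F\<subseteq>mspace Y. mcball_of Y x r \<subseteq> (\<Union>y\<in>F. mcball_of Y y (r / 2)) \<and>
        finite F \<and> card F \<le> N"
      using F im by (intro exI[of _ "f ` F"]) auto
  qed
qed

lemma delta_uniformly_disconnected_isometric:
  assumes "isometric X Y" "delta_uniformly_disconnected \<delta> X"
  shows "delta_uniformly_disconnected \<delta> Y"
proof -
  obtain g where g: "isometric_embedding Y X g"
    using isometricE_inverse[OF assms(1)] by metis
  have gX: "g y \<in> mspace X" if "y \<in> mspace Y" for y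
    using g that unfolding isometric_embedding_def by auto
  have gd: "mdist X (g x) (g y) = mdist Y x y" if "x \<in> mspace Y" "y \<in> mspace Y" for x y
    using g that unfolding isometric_embedding_def by auto
  have inj: "inj_on g (mspace Y)" using g by (rule isometric_embedding_inj)
  show ?thesis
    unfolding delta_uniformly_disconnected_def
  proof (intro allI impI)
    fix N :: nat and z
    assume z: "\<forall>i\<in>{1..N}. z i \<in> mspace Y" and nc: "\<exists>i\<in>{1..N}. \<exists>j\<in>{1..N}. z i \<noteq> z j"
    have "\<not> N \<le> 1"
    proof
      assume "N \<le> 1"
      then have "i = 1" if "i \<in> {1..N}" for i using that by auto
      then show False using nc by metis
    qed
    then have N: "N \<ge> 2" by simp
    have nc': "\<exists>i\<in>{1..N}. \<exists>j\<in>{1..N}. (g \<circ> z) i \<noteq> (g \<circ> z) j"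
      using nc inj z unfolding inj_on_def by (metis comp_apply)
    have z': "\<forall>i\<in>{1..N}. (g \<circ> z) i \<in> mspace X" using z gX by simp
    have le: "\<delta> * mdist X ((g \<circ> z) 1) ((g \<circ> z) N) \<le>
        Max ((\<lambda>i. mdist X ((g \<circ> z) i) ((g \<circ> z) (i + 1))) ` {1..N - 1})"
      using assms(2) z' nc' unfolding delta_uniformly_disconnected_def by blast
    have "(\<lambda>i. mdist X ((g \<circ> z) i) ((g \<circ> z) (i + 1))) ` {1..N - 1} =
        (\<lambda>i. mdist Y (z i) (z (i + 1))) ` {1..N - 1}"
      using z by (intro image_cong refl) (auto intro!: gd)
    moreover have "mdist X ((g \<circ> z) 1) ((g \<circ> z) N) = mdist Y (z 1) (z N)"
      using z N by (auto intro!: gd)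
    ultimately show "\<delta> * mdist Y (z 1) (z N) \<le> Max ((\<lambda>i. mdist Y (z i) (z (i + 1))) ` {1..N - 1})"
      using le by simp
  qed
qed

lemma c_uniformly_perfect_isometric:
  assumes "isometric X Y" "c_uniformly_perfect c X"
  shows "c_uniformly_perfect c Y"
proof -
  obtain f where f: "isometric_embedding X Y f" and im: "f ` mspace X = mspace Y"
    using assms(1) unfolding isometric_def by blast
  have fd: "mdist Y (f x) (f y) = mdist X x y" if "x \<in> mspace X" "y \<in> mspace X" for x y
    using f that unfolding isometric_embedding_def by auto
  have diam: "mdiameter Y = mdiameter X"
    unfolding mdiameter_def im[symmetric] image_image by (intro SUP_cong refl) (simp add: fd)
  show ?thesis
    using assms(2) unfolding c_uniformly_perfect_def diam im[symmetric] by (auto simp: fd)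
qed

lift_definition doubling_class :: "gh_space \<Rightarrow> bool" is doubling
proof -
  fix X Y assume "gh_rel X Y"
  then have "isometric X Y" "isometric Y X" unfolding gh_rel_def by (blast intro: isometric_sym)+
  then show "doubling X = doubling Y"
    unfolding doubling_def by (blast intro: N_doubling_isometric)
qed

lift_definition uniformly_disconnected_class :: "gh_space \<Rightarrow> bool" is uniformly_disconnected
proof -
  fix X Y assume "gh_rel X Y"
  then have "isometric X Y" "isometric Y X" unfolding gh_rel_def by (blast intro: isometric_sym)+
  then show "uniformly_disconnected X = uniformly_disconnected Y"
    unfolding uniformly_disconnected_def by (blast intro: delta_uniformly_disconnected_isometric)
qed

lift_definition uniformly_perfect_class :: "gh_space \<Rightarrow> bool" is uniformly_perfect
proof -
  fix X Y assume "gh_rel X Y"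
  then have "isometric X Y" "isometric Y X" unfolding gh_rel_def by (blast intro: isometric_sym)+
  then show "uniformly_perfect X = uniformly_perfect Y"
    unfolding uniformly_perfect_def by (blast intro: c_uniformly_perfect_isometric)
qed

definition DO :: "gh_space set" where "DO = {x. doubling_class x}"

definition UD :: "gh_space set" where "UD = {x. uniformly_disconnected_class x}"

definition UP :: "gh_space set" where "UP = {x. uniformly_perfect_class x}"


section \<open>Topological smallness\<close>

definition dense_in :: "'a topology \<Rightarrow> 'a set \<Rightarrow> bool" where
  "dense_in T S \<longleftrightarrow> S \<subseteq> topspace T \<and> T closure_of S = topspace T"

definition nowhere_dense_in :: "'a topology \<Rightarrow> 'a set \<Rightarrow> bool" where
  "nowhere_dense_in T S \<longleftrightarrow> S \<subseteq> topspace T \<and> T interior_of (T closure_of S) = {}"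

definition meager_in :: "'a topology \<Rightarrow> 'a set \<Rightarrow> bool" where
  "meager_in T S \<longleftrightarrow> (countable union_of nowhere_dense_in T) S"


section \<open>Real numbers suffice as points\<close>

lemma transport_metric:
  fixes X :: "'a metric" and h :: "'a \<Rightarrow> 'b"
  assumes inj: "inj_on h (mspace X)"
  obtains Y :: "'b metric" where "isometric_embedding X Y h" "h ` mspace X = mspace Y"
proof -
  let ?k = "inv_into (mspace X) h"
  have k: "?k (h x) = x" if "x \<in> mspace X" for x
    using inj that by simp
  define d where "d = (\<lambda>u v. mdist X (?k u) (?k v))"
  interpret X: Metric_space "mspace X" "mdist X" by simp
  interpret Y: Metric_space "h ` mspace X" d
  proof
    show "0 \<le> d u v" for u v by (simp add: d_def)
    show "d u v = d v u" for u v by (simp add: d_def X.commute)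
    show "d u v = 0 \<longleftrightarrow> u = v" if "u \<in> h ` mspace X" "v \<in> h ` mspace X" for u v
      using that by (auto simp: d_def k)
    show "d u w \<le> d u v + d v w"
      if "u \<in> h ` mspace X" "v \<in> h ` mspace X" "w \<in> h ` mspace X" for u v w
      using that by (auto simp: d_def k intro: X.triangle)
  qed
  have "isometric_embedding X (metric (h ` mspace X, d)) h"
    unfolding isometric_embedding_def Y.mdist_metric Y.mspace_metric by (simp add: d_def k)
  then show thesis using that[of "metric (h ` mspace X, d)"] by simp
qed

lemma isometric_compact_space:
  assumes "isometric X Y" "compact_space (mtopology_of X)"
  shows "compact_space (mtopology_of Y)"
proof -
  obtain f where f: "isometric_embedding X Y f" "f ` mspace X = mspace Y"
    using assms(1) unfolding isometric_def by blast
  interpret Metric_space12 "mspace X" "mdist X" "mspace Y" "mdist Y"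
    by (rule Metric_space12_mspace_mdist)
  have "homeomorphic_map (mtopology_of X) (mtopology_of Y) f"
    unfolding mtopology_of_def using f
    by (intro isometry_imp_homeomorphic_map) (auto simp: isometric_embedding_def)
  then show ?thesis
    using assms(2) homeomorphic_compact_space homeomorphic_map_imp_homeomorphic_space by blast
qed

theorem compact_metric_has_real_copy:
  fixes X :: "'a metric"
  assumes "nonempty_compact_metric X"
  shows "\<exists>Y :: real metric. nonempty_compact_metric Y \<and> isometric X Y"
proof -
  interpret X: Metric_space "mspace X" "mdist X" by simp
  have cs: "compact_space X.mtopology"
    using assms by (simp add: nonempty_compact_metric_def mtopology_of_def)
  have "X.mtotally_bounded (mspace X)"
    using cs X.compact_space_eq_mcomplete_mtotally_bounded by blast
  then have "\<exists>K. finite K \<and> K \<subseteq> mspace X \<and> mspace X \<subseteq> (\<Union>x\<in>K. X.mball x (1 / real (Suc n)))" for n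
    unfolding X.mtotally_bounded_def by simp
  then obtain K where K: "\<And>n. finite (K n)" "\<And>n. K n \<subseteq> mspace X"
      "\<And>n. mspace X \<subseteq> (\<Union>x\<in>K n. X.mball x (1 / real (Suc n)))"
    by metis
  define S where "S = (SIGMA n:(UNIV::nat set). K n)"
  have "countable S" unfolding S_def using K(1) by (intro countable_SIGMA) (auto intro: countable_finite)
  then obtain e :: "nat \<times> 'a \<Rightarrow> nat" where e: "inj_on e S" by (auto simp: countable_def)
  define c where "c = (\<lambda>x. e ` {(n, y) \<in> S. x \<in> X.mball y (1 / real (Suc n))})"
  have "inj_on c (mspace X)"
  proof (rule inj_onI, rule ccontr)
    fix x x' assume x: "x \<in> mspace X" "x' \<in> mspace X" "c x = c x'" "x \<noteq> x'"
    then have "0 < mdist X x x'" by (simp add: X.mdist_pos_less)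
    then obtain n where n: "1 / real (Suc n) < mdist X x x' / 2"
      using nat_approx_posE[of "mdist X x x' / 2"] by auto
    obtain y where y: "y \<in> K n" "x \<in> X.mball y (1 / real (Suc n))" using K(3)[of n] x(1) by blast
    have S: "(n, y) \<in> S" using y by (simp add: S_def)
    have "e (n, y) \<in> c x'" using x(3) y S unfolding c_def by blast
    then have "x' \<in> X.mball y (1 / real (Suc n))"
      unfolding c_def using e S by (auto simp: inj_on_def)
    then have "mdist X x x' < 1 / real (Suc n) + 1 / real (Suc n)"
      using y(2) X.triangle[of x y x'] X.commute[of x y] by auto
    then show False using n by linarith
  qed
  moreover obtain b :: "nat set \<Rightarrow> real" where b: "inj b"
    using nat_sets_eqpoll_reals by (auto simp: eqpoll_def bij_betw_def)
  ultimately have "inj_on (b \<circ> c) (mspace X)"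
    by (meson comp_inj_on inj_on_subset subset_UNIV)
  then obtain Y :: "real metric" where Y: "isometric_embedding X Y (b \<circ> c)" "(b \<circ> c) ` mspace X = mspace Y"
    by (rule transport_metric)
  then have "isometric X Y" unfolding isometric_def by blast
  moreover have "nonempty_compact_metric Y"
    using assms isometric_compact_space[OF \<open>isometric X Y\<close>] Y(2)
    unfolding nonempty_compact_metric_def by auto
  ultimately show ?thesis by blast
qed

theorem gromov_hausdorff_ambient_real:
  fixes X Y :: "real metric" and Z :: "'c metric"
  assumes f: "isometric_embedding X Z f" and g: "isometric_embedding Y Z g"
  shows "\<exists>(Z' :: real metric) f' g'. isometric_embedding X Z' f' \<and> isometric_embedding Y Z' g' \<and>
    hausdorff_dist Z' (f' ` mspace X) (g' ` mspace Y) = hausdorff_dist Z (f ` mspace X) (g ` mspace Y)"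
proof -
  let ?A = "f ` mspace X" and ?B = "g ` mspace Y"
  have AB: "?A \<subseteq> mspace Z" "?B \<subseteq> mspace Z"
    using f g unfolding isometric_embedding_def by auto
  define W where "W = submetric Z (?A \<union> ?B)"
  have W: "mspace W = ?A \<union> ?B" "mdist W = mdist Z"
    using AB by (auto simp: W_def)
  define h where "h = (\<lambda>w. if w \<in> ?A then exp (inv_into (mspace X) f w)
                              else - exp (inv_into (mspace Y) g w))"
  have "inj_on h (mspace W)"
  proof (rule inj_onI)
    fix u v assume uv: "u \<in> mspace W" "v \<in> mspace W" "h u = h v"
    have pn: "exp a \<noteq> - exp b" for a b :: real
      using exp_gt_zero[of a] exp_gt_zero[of b] by linarith
    show "u = v"
    proof (cases "u \<in> ?A")
      case True
      then have "v \<in> ?A" using uv(3) pn by (auto simp: h_def split: if_splits)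
      then show ?thesis using True uv(3) by (auto simp: h_def dest: inv_into_injective)
    next
      case False
      then have vA: "v \<notin> ?A" using uv(3) pn by (metis h_def)
      then have "u \<in> ?B" "v \<in> ?B" using uv False W by auto
      then show ?thesis using False vA uv(3) unfolding h_def by (auto dest: inv_into_injective)
    qed
  qed
  then obtain Z' :: "real metric" where Z': "isometric_embedding W Z' h" "h ` mspace W = mspace Z'"
    by (rule transport_metric)
  have hd: "mdist Z' (h u) (h v) = mdist Z u v" if "u \<in> ?A \<union> ?B" "v \<in> ?A \<union> ?B" for u v
    using Z'(1) that W unfolding isometric_embedding_def by metis
  have "isometric_embedding X W f" "isometric_embedding Y W g"
    using f g W unfolding isometric_embedding_def by auto
  then have "isometric_embedding X Z' (h \<circ> f)" "isometric_embedding Y Z' (h \<circ> g)"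
    using Z'(1) isometric_embedding_comp by blast+
  moreover have "hausdorff_dist Z' ((h \<circ> f) ` mspace X) ((h \<circ> g) ` mspace Y) = hausdorff_dist Z ?A ?B"
    unfolding hausdorff_dist_def image_image comp_def
    by (intro arg_cong2[where f=max] SUP_cong INF_cong refl hd) auto
  ultimately show ?thesis by blast
qed

end

theory Submission
  imports Defs
begin

text \<open>
  Up to a factor 2, the Gromov--Hausdorff distance is the infimal distortion of a correspondence, so
  a condition on distances that tolerates small errors passes to limits. Once some slack is added,
  each of the three classes is a countable union, over its parameter (\<open>N\<close>, \<open>\<delta>\<close> or \<open>c\<close>), of sets
  defined by such a condition, hence of closed sets.

  Any space is close to \<open>A \<times> K\<close> for a finite net \<open>A\<close> and a compact space \<open>K\<close> of small
  diameter. If \<open>K\<close> consists of \<open>M + 1\<close> equidistant points, the product is finite, so doubling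
  and uniformly disconnected, but it is not uniformly perfect and violates the doubling condition
  for \<open>M\<close>. If \<open>K\<close> is an interval, the product is uniformly perfect and not uniformly
  disconnected. So each class is dense, and each of the closed sets has empty interior.
\<close>

text \<open>Correspondences also settle a typing problem: representatives have real points, gluings
  live on a sum type and perturbed spaces on a product type, and \<open>gh_close\<close> compares
  all of them directly. Doubling and perfectness assert that certain points exist, and the points
  found in approximating spaces depend on the error; slack lets them be carried over as they are,
  without extracting convergent subsequences. Uniform disconnectedness asserts a non-strict
  inequality about finitely many given points, so it is closed as it stands. A finite space is
  always doubling, so for \<open>DO\<close> the perturbation has to be chosen after the constant it
  defeats. For \<open>UD\<close> and \<open>UP\<close> one perturbation leaves the whole
  class.\<close>

lemma mspace_nonempty: "nonempty_compact_metric X \<Longrightarrow> mspace X \<noteq> {}"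
  by (simp add: nonempty_compact_metric_def)

lemma nonempty_compact_metric_bounded:
  assumes "nonempty_compact_metric X"
  obtains D where "\<And>x y. x \<in> mspace X \<Longrightarrow> y \<in> mspace X \<Longrightarrow> mdist X x y \<le> D"
proof -
  interpret X: Metric_space "mspace X" "mdist X" by simp
  have "compactin X.mtopology (mspace X)"
    using assms by (simp add: nonempty_compact_metric_def mtopology_of_def compact_space_def)
  then have "X.mbounded (mspace X)"
    by (rule X.compactin_imp_mbounded)
  then show thesis
    using that unfolding X.mbounded_alt by blast
qed

section \<open>The Hausdorff distance\<close>

lemma hausdorff_dist_le:
  assumes "A \<noteq> {}" "B \<noteq> {}"
    and "\<And>a. a \<in> A \<Longrightarrow> \<exists>b\<in>B. mdist Z a b \<le> r"
    and "\<And>b. b \<in> B \<Longrightarrow> \<exists>a\<in>A. mdist Z a b \<le> r"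
  shows "hausdorff_dist Z A B \<le> r"
proof -
  have "(INF b\<in>B. mdist Z a b) \<le> r" if "a \<in> A" for a
    using assms(3)[OF that] by (auto intro!: cINF_lower2[where f="mdist Z a"] bdd_belowI[of _ 0])
  moreover have "(INF a\<in>A. mdist Z a b) \<le> r" if "b \<in> B" for b
    using assms(4)[OF that] by (auto intro!: cINF_lower2[where f="\<lambda>a. mdist Z a b"] bdd_belowI[of _ 0])
  ultimately show ?thesis
    unfolding hausdorff_dist_def using assms(1,2) by (auto intro!: cSUP_least)
qed

text \<open>The bound \<open>D\<close> makes the real-valued supremum an actual upper bound of the
  infima; a strict inequality then yields a witness even if no infimum is attained.\<close>

lemma cINF_SUP_lessD:
  fixes d :: "'a \<Rightarrow> 'b \<Rightarrow> real"
  assumes "A \<noteq> {}" "B \<noteq> {}"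
    and d: "\<And>a b. a \<in> A \<Longrightarrow> b \<in> B \<Longrightarrow> 0 \<le> d a b \<and> d a b \<le> D"
    and less: "(SUP a\<in>A. INF b\<in>B. d a b) < r" and a: "a \<in> A"
  shows "\<exists>b\<in>B. d a b < r"
proof -
  obtain b where b: "b \<in> B" using assms(2) by blast
  have "(INF b\<in>B. d a b) \<le> D" if "a \<in> A" for a
    by (rule cINF_lower2[OF _ b]) (use d that b in \<open>auto intro!: bdd_belowI[of _ 0]\<close>)
  then have "bdd_above ((\<lambda>a. INF b\<in>B. d a b) ` A)" by (intro bdd_aboveI[of _ D]) auto
  then have "(INF b\<in>B. d a b) \<le> (SUP a\<in>A. INF b\<in>B. d a b)" by (rule cSUP_upper[OF a])
  with less have "Inf (d a ` B) < r" by linarith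
  from cInf_lessD[OF _ this] show ?thesis using assms(2) by auto
qed

lemma hausdorff_dist_lessD:
  assumes "A \<noteq> {}" "B \<noteq> {}"
    and D: "\<And>a b. a \<in> A \<Longrightarrow> b \<in> B \<Longrightarrow> mdist Z a b \<le> D"
    and less: "hausdorff_dist Z A B < r"
  shows "a \<in> A \<Longrightarrow> \<exists>b\<in>B. mdist Z a b < r" and "b \<in> B \<Longrightarrow> \<exists>a\<in>A. mdist Z a b < r"
proof -
  have "(SUP a\<in>A. INF b\<in>B. mdist Z a b) < r" "(SUP b\<in>B. INF a\<in>A. mdist Z a b) < r"
    using less by (simp_all add: hausdorff_dist_def)
  note less = this
  show "\<exists>b\<in>B. mdist Z a b < r" if "a \<in> A"
    by (rule cINF_SUP_lessD[where d="mdist Z", OF assms(1,2) _ less(1) that])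
      (auto intro: D)
  show "\<exists>a\<in>A. mdist Z a b < r" if "b \<in> B"
    by (rule cINF_SUP_lessD[where d="\<lambda>b a. mdist Z a b", OF assms(2,1) _ less(2) that])
      (auto intro: D)
qed

section \<open>Correspondences\<close>

text \<open>A relation serves better than an approximately isometric map: its converse has the same
  error, and composition adds errors.\<close>

definition correspondence :: "'a metric \<Rightarrow> 'b metric \<Rightarrow> real \<Rightarrow> ('a \<times> 'b) set \<Rightarrow> bool" where
  "correspondence X Y e R \<longleftrightarrow>
     R \<subseteq> mspace X \<times> mspace Y \<and>
     (\<forall>x\<in>mspace X. \<exists>y. (x, y) \<in> R) \<and> (\<forall>y\<in>mspace Y. \<exists>x. (x, y) \<in> R) \<and>
     (\<forall>x y x' y'. (x, y) \<in> R \<longrightarrow> (x', y') \<in> R \<longrightarrow> \<bar>mdist X x x' - mdist Y y y'\<bar> \<le> e)"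

definition gh_close :: "'a metric \<Rightarrow> 'b metric \<Rightarrow> real \<Rightarrow> bool" where
  "gh_close X Y e \<longleftrightarrow> (\<exists>R. correspondence X Y e R)"

lemma gh_closeE:
  assumes "gh_close X Y e"
  obtains R where "\<And>x y. (x, y) \<in> R \<Longrightarrow> x \<in> mspace X \<and> y \<in> mspace Y"
    "\<And>x. x \<in> mspace X \<Longrightarrow> \<exists>y. (x, y) \<in> R" "\<And>y. y \<in> mspace Y \<Longrightarrow> \<exists>x. (x, y) \<in> R"
    "\<And>x y x' y'. (x, y) \<in> R \<Longrightarrow> (x', y') \<in> R \<Longrightarrow> \<bar>mdist X x x' - mdist Y y y'\<bar> \<le> e"
proof -
  obtain R where R: "correspondence X Y e R" using assms by (auto simp: gh_close_def)
  show thesis by (rule that[of R]) (use R in \<open>auto simp: correspondence_def\<close>)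
qed

lemma gh_close_mono:
  assumes "gh_close X Y e" "e \<le> e'"
  shows "gh_close X Y e'"
proof -
  obtain R where R: "correspondence X Y e R" using assms(1) by (auto simp: gh_close_def)
  have "\<bar>mdist X x x' - mdist Y y y'\<bar> \<le> e'" if "(x, y) \<in> R" "(x', y') \<in> R" for x y x' y'
  proof -
    have "\<bar>mdist X x x' - mdist Y y y'\<bar> \<le> e"
      using R that unfolding correspondence_def by blast
    then show ?thesis using assms(2) by linarith
  qed
  then have "correspondence X Y e' R"
    using R unfolding correspondence_def by blast
  then show ?thesis by (auto simp: gh_close_def)
qed

lemma gh_close_sym:
  assumes "gh_close X Y e"
  shows "gh_close Y X e"
proof -
  obtain R where R: "correspondence X Y e R" using assms by (auto simp: gh_close_def)
  have "correspondence Y X e (R\<inverse>)"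
    unfolding correspondence_def
  proof (intro conjI allI impI)
    fix y x y' x' assume "(y, x) \<in> R\<inverse>" "(y', x') \<in> R\<inverse>"
    then have "\<bar>mdist X x x' - mdist Y y y'\<bar> \<le> e"
      using R unfolding correspondence_def by blast
    then show "\<bar>mdist Y y y' - mdist X x x'\<bar> \<le> e" by linarith
  qed (use R in \<open>auto simp: correspondence_def\<close>)
  then show ?thesis by (auto simp: gh_close_def)
qed

lemma gh_close_trans:
  assumes "gh_close X Y a" "gh_close Y Z b"
  shows "gh_close X Z (a + b)"
proof -
  obtain R S where R: "correspondence X Y a R" and S: "correspondence Y Z b S"
    using assms by (auto simp: gh_close_def)
  have sub: "R \<subseteq> mspace X \<times> mspace Y" "S \<subseteq> mspace Y \<times> mspace Z"
    and X: "\<forall>x\<in>mspace X. \<exists>y. (x, y) \<in> R" and Y: "\<forall>y\<in>mspace Y. \<exists>x. (x, y) \<in> R"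
    and Y': "\<forall>y\<in>mspace Y. \<exists>z. (y, z) \<in> S" and Z: "\<forall>z\<in>mspace Z. \<exists>y. (y, z) \<in> S"
    using R S by (simp_all add: correspondence_def)
  have "correspondence X Z (a + b) (R O S)"
    unfolding correspondence_def
  proof (intro conjI ballI allI impI)
    show "R O S \<subseteq> mspace X \<times> mspace Z" using sub by auto
    show "\<exists>z. (x, z) \<in> R O S" if "x \<in> mspace X" for x
      using that X Y' sub(1) by (meson SigmaD2 relcomp.relcompI subsetD)
    show "\<exists>x. (x, z) \<in> R O S" if "z \<in> mspace Z" for z
      using that Y Z sub(2) by (meson SigmaD1 relcomp.relcompI subsetD)
    fix x z x' z' assume "(x, z) \<in> R O S" "(x', z') \<in> R O S"
    then obtain y y' where "(x, y) \<in> R" "(y, z) \<in> S" "(x', y') \<in> R" "(y', z') \<in> S" by auto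
    then have "\<bar>mdist X x x' - mdist Y y y'\<bar> \<le> a" "\<bar>mdist Y y y' - mdist Z z z'\<bar> \<le> b"
      using R S unfolding correspondence_def by blast+
    then show "\<bar>mdist X x x' - mdist Z z z'\<bar> \<le> a + b" by linarith
  qed
  then show ?thesis by (auto simp: gh_close_def)
qed

lemma gh_close_nonneg:
  assumes "gh_close X Y e" "mspace X \<noteq> {}"
  shows "0 \<le> e"
proof -
  obtain R where R: "correspondence X Y e R" using assms(1) by (auto simp: gh_close_def)
  then obtain x y where "(x, y) \<in> R" using assms(2) unfolding correspondence_def by blast
  then have "\<bar>mdist X x x - mdist Y y y\<bar> \<le> e" using R unfolding correspondence_def by blast
  then show ?thesis by linarith
qed

lemma isometric_imp_gh_close:
  assumes "isometric X Y"
  shows "gh_close X Y 0"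
proof -
  obtain f where f: "isometric_embedding X Y f" "f ` mspace X = mspace Y"
    using assms by (auto simp: isometric_def)
  then have "correspondence X Y 0 ((\<lambda>x. (x, f x)) ` mspace X)"
    unfolding correspondence_def isometric_embedding_def by (auto simp: image_iff)
  then show ?thesis by (auto simp: gh_close_def)
qed

text \<open>For bounded spaces the full product relation is a correspondence. After gluing, this
  shows that the infimum defining \<open>gromov_hausdorff\<close> is over a non-empty set.\<close>

lemma nonempty_compact_imp_gh_close:
  assumes "nonempty_compact_metric X" "nonempty_compact_metric Y"
  obtains r where "0 < r" "gh_close X Y r"
proof -
  obtain D where D: "\<And>x y. x \<in> mspace X \<Longrightarrow> y \<in> mspace X \<Longrightarrow> mdist X x y \<le> D"
    using nonempty_compact_metric_bounded[OF assms(1)] by metis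
  obtain E where E: "\<And>x y. x \<in> mspace Y \<Longrightarrow> y \<in> mspace Y \<Longrightarrow> mdist Y x y \<le> E"
    using nonempty_compact_metric_bounded[OF assms(2)] by metis
  have ne: "mspace X \<noteq> {}" "mspace Y \<noteq> {}" using assms by (auto simp: nonempty_compact_metric_def)
  have "\<bar>mdist X x x' - mdist Y y y'\<bar> \<le> \<bar>D\<bar> + \<bar>E\<bar> + 1"
    if "x \<in> mspace X" "x' \<in> mspace X" "y \<in> mspace Y" "y' \<in> mspace Y" for x x' y y'
    using D[OF that(1,2)] E[OF that(3,4)] mdist_nonneg[of X x x'] mdist_nonneg[of Y y y'] by linarith
  then have "correspondence X Y (\<bar>D\<bar> + \<bar>E\<bar> + 1) (mspace X \<times> mspace Y)"
    unfolding correspondence_def using ne by blast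
  then have "gh_close X Y (\<bar>D\<bar> + \<bar>E\<bar> + 1)" by (auto simp: gh_close_def)
  moreover have "0 < \<bar>D\<bar> + \<bar>E\<bar> + 1" by linarith
  ultimately show thesis using that by blast
qed

text \<open>
  The cross distance \<open>\<delta>\<close> travels through a corresponding pair and pays the toll \<open>r\<close>, which
  keeps the glued distance positive and absorbs the distortion in the triangle inequality.
\<close>

lemma glue_along_correspondence:
  fixes X :: "'a metric" and Y :: "'b metric"
  assumes "gh_close X Y (2 * r)" "0 < r" "mspace X \<noteq> {}"
  obtains Z :: "('a + 'b) metric" where
    "isometric_embedding X Z Inl" "isometric_embedding Y Z Inr"
    "hausdorff_dist Z (Inl ` mspace X) (Inr ` mspace Y) \<le> r"
proof -
  interpret X: Metric_space "mspace X" "mdist X" by simp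
  interpret Y: Metric_space "mspace Y" "mdist Y" by simp
  obtain R where R: "\<And>x y. (x, y) \<in> R \<Longrightarrow> x \<in> mspace X \<and> y \<in> mspace Y"
    and RX: "\<And>x. x \<in> mspace X \<Longrightarrow> \<exists>y. (x, y) \<in> R" and RY: "\<And>y. y \<in> mspace Y \<Longrightarrow> \<exists>x. (x, y) \<in> R"
    and dis: "\<And>x y x' y'. (x, y) \<in> R \<Longrightarrow> (x', y') \<in> R \<Longrightarrow> \<bar>mdist X x x' - mdist Y y y'\<bar> \<le> 2 * r"
    using gh_closeE[OF assms(1)] by metis
  have Rne: "R \<noteq> {}" using RX assms(3) by blast
  define \<delta> where "\<delta> = (\<lambda>x y. r + (INF p\<in>R. mdist X x (fst p) + mdist Y (snd p) y))"
  have \<delta>_le: "\<delta> x y \<le> r + mdist X x u + mdist Y v y" if "(u, v) \<in> R" for x y u v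
  proof -
    have "(INF p\<in>R. mdist X x (fst p) + mdist Y (snd p) y) \<le> mdist X x (fst (u, v)) + mdist Y (snd (u, v)) y"
      by (rule cINF_lower[OF _ that]) (auto intro!: bdd_belowI[of _ 0])
    then show ?thesis by (simp add: \<delta>_def)
  qed
  have \<delta>_ge: "c \<le> \<delta> x y" if "\<And>u v. (u, v) \<in> R \<Longrightarrow> c \<le> r + mdist X x u + mdist Y v y" for x y c
  proof -
    have "c - r \<le> (INF p\<in>R. mdist X x (fst p) + mdist Y (snd p) y)"
      by (rule cINF_greatest[OF Rne]) (use that in fastforce)
    then show ?thesis by (simp add: \<delta>_def)
  qed
  have \<delta>_pos: "0 < \<delta> x y" for x y
    using \<delta>_ge[of r x y] assms(2) by fastforce
  have \<delta>_nz: "\<delta> x y \<noteq> 0" for x y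
    using \<delta>_pos[of x y] by simp
  have triX: "\<delta> x y \<le> mdist X x x' + \<delta> x' y" if "x \<in> mspace X" "x' \<in> mspace X" for x x' y
  proof -
    have "\<delta> x y - mdist X x x' \<le> r + mdist X x' u + mdist Y v y" if uv: "(u, v) \<in> R" for u v
      using \<delta>_le[OF uv, of x y] X.triangle[of x x' u] R[OF uv] \<open>x \<in> _\<close> \<open>x' \<in> _\<close> by linarith
    from \<delta>_ge[OF this] show ?thesis by simp
  qed
  have triY: "\<delta> x y \<le> \<delta> x y' + mdist Y y' y" if "y \<in> mspace Y" "y' \<in> mspace Y" for x y y'
  proof -
    have "\<delta> x y - mdist Y y' y \<le> r + mdist X x u + mdist Y v y'" if uv: "(u, v) \<in> R" for u v
      using \<delta>_le[OF uv, of x y] Y.triangle[of v y' y] R[OF uv] \<open>y \<in> _\<close> \<open>y' \<in> _\<close> by linarith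
    from \<delta>_ge[OF this] show ?thesis by simp
  qed
  have triX': "\<delta> x' y \<le> \<delta> x y + mdist X x x'" if "x \<in> mspace X" "x' \<in> mspace X" for x x' y
    using triX[of x' x y] that by (simp add: X.commute)
  have triY': "\<delta> x y' \<le> mdist Y y' y + \<delta> x y" if "y \<in> mspace Y" "y' \<in> mspace Y" for x y y'
    using triY[of y' y x] that by (simp add: Y.commute)
  have crossX: "mdist X x x' \<le> \<delta> x y + \<delta> x' y"
    if "x \<in> mspace X" "x' \<in> mspace X" "y \<in> mspace Y" for x x' y
  proof -
    have "mdist X x x' - (r + mdist X x' u' + mdist Y v' y) \<le> r + mdist X x u + mdist Y v y"
      if uv: "(u, v) \<in> R" "(u', v') \<in> R" for u v u' v'
      using dis[OF uv] X.triangle[of x u u'] X.triangle[of x u' x'] Y.triangle[of v y v']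
        R[OF uv(1)] R[OF uv(2)] \<open>x \<in> _\<close> \<open>x' \<in> _\<close> \<open>y \<in> _\<close> X.commute[of x' u'] Y.commute[of v' y]
      by linarith
    \<comment> \<open>The two infima are handled one at a time: first over \<open>(u, v)\<close>
      with \<open>(u', v')\<close> fixed, then over \<open>(u', v')\<close>.\<close>
    from \<delta>_ge[OF this] have "mdist X x x' - \<delta> x y \<le> r + mdist X x' u' + mdist Y v' y" if "(u', v') \<in> R" for u' v'
      using that by fastforce
    from \<delta>_ge[OF this] show ?thesis by simp
  qed
  have crossY: "mdist Y y y' \<le> \<delta> x y + \<delta> x y'"
    if "y \<in> mspace Y" "y' \<in> mspace Y" "x \<in> mspace X" for x y y'
  proof -
    have "mdist Y y y' - (r + mdist X x u' + mdist Y v' y') \<le> r + mdist X x u + mdist Y v y"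
      if uv: "(u, v) \<in> R" "(u', v') \<in> R" for u v u' v'
      using dis[OF uv] Y.triangle[of y v v'] Y.triangle[of y v' y'] X.triangle[of u x u']
        R[OF uv(1)] R[OF uv(2)] \<open>x \<in> _\<close> \<open>y' \<in> _\<close> \<open>y \<in> _\<close> Y.commute[of y v] X.commute[of u x]
      by linarith
    from \<delta>_ge[OF this] have "mdist Y y y' - \<delta> x y \<le> r + mdist X x u' + mdist Y v' y'" if "(u', v') \<in> R" for u' v'
      using that by fastforce
    from \<delta>_ge[OF this] show ?thesis by simp
  qed
  define d where "d = (\<lambda>p q. case p of
      Inl x \<Rightarrow> (case q of Inl x' \<Rightarrow> mdist X x x' | Inr y \<Rightarrow> \<delta> x y)
    | Inr y \<Rightarrow> (case q of Inl x \<Rightarrow> \<delta> x y | Inr y' \<Rightarrow> mdist Y y y'))"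
  have d: "d (Inl x) (Inl x') = mdist X x x'" "d (Inl x) (Inr y) = \<delta> x y"
    "d (Inr y) (Inl x) = \<delta> x y" "d (Inr y) (Inr y') = mdist Y y y'" for x x' y y'
    by (simp_all add: d_def)
  interpret Z: Metric_space "Inl ` mspace X \<union> Inr ` mspace Y" d
  proof
    show "0 \<le> d p q" for p q
      by (cases p; cases q) (auto simp: d less_imp_le[OF \<delta>_pos])
    show "d p q = d q p" for p q
      by (cases p; cases q) (auto simp: d X.commute Y.commute)
    show "d p q = 0 \<longleftrightarrow> p = q"
      if "p \<in> Inl ` mspace X \<union> Inr ` mspace Y" "q \<in> Inl ` mspace X \<union> Inr ` mspace Y" for p q
      using that \<delta>_nz by (auto simp: d)
    show "d p q \<le> d p s + d s q"
      if "p \<in> Inl ` mspace X \<union> Inr ` mspace Y" "s \<in> Inl ` mspace X \<union> Inr ` mspace Y"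
        "q \<in> Inl ` mspace X \<union> Inr ` mspace Y" for p s q
      using that
      by (cases p; cases s; cases q)
        (auto simp: d intro: X.triangle Y.triangle triX triX' triY triY' crossX crossY)
  qed
  let ?Z = "metric (Inl ` mspace X \<union> Inr ` mspace Y, d)"
  have "isometric_embedding X ?Z Inl" "isometric_embedding Y ?Z Inr"
    by (auto simp: isometric_embedding_def d)
  moreover have "hausdorff_dist ?Z (Inl ` mspace X) (Inr ` mspace Y) \<le> r"
  proof (rule hausdorff_dist_le)
    have le: "\<delta> x y \<le> r" if "(x, y) \<in> R" for x y
      using \<delta>_le[OF that, of x y] R[OF that] by simp
    show "\<exists>b\<in>Inr ` mspace Y. mdist ?Z a b \<le> r" if "a \<in> Inl ` mspace X" for a
      using that RX le R by (fastforce simp: d)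
    show "\<exists>a\<in>Inl ` mspace X. mdist ?Z a b \<le> r" if "b \<in> Inr ` mspace Y" for b
      using that RY le R by (fastforce simp: d)
  qed (use assms(3) RX R in blast)+
  ultimately show thesis using that by blast
qed

text \<open>Relating points whose copies lie less than \<open>r\<close> apart changes a distance by
  less than \<open>r\<close> at each of its two ends; strictness of \<open>less\<close> gives every
  point a partner.\<close>

lemma hausdorff_dist_less_imp_gh_close:
  assumes X: "nonempty_compact_metric X" and Y: "nonempty_compact_metric Y"
    and f: "isometric_embedding X Z f" and g: "isometric_embedding Y Z g"
    and less: "hausdorff_dist Z (f ` mspace X) (g ` mspace Y) < r"
  shows "gh_close X Y (2 * r)"
proof -
  interpret Z: Metric_space "mspace Z" "mdist Z" by simp
  have fZ: "f x \<in> mspace Z" if "x \<in> mspace X" for x using f that by (auto simp: isometric_embedding_def)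
  have gZ: "g y \<in> mspace Z" if "y \<in> mspace Y" for y using g that by (auto simp: isometric_embedding_def)
  obtain x0 y0 where x0: "x0 \<in> mspace X" and y0: "y0 \<in> mspace Y"
    using mspace_nonempty[OF X] mspace_nonempty[OF Y] by blast
  obtain D where D: "\<And>x x'. x \<in> mspace X \<Longrightarrow> x' \<in> mspace X \<Longrightarrow> mdist X x x' \<le> D"
    using nonempty_compact_metric_bounded[OF X] by metis
  obtain E where E: "\<And>x x'. x \<in> mspace Y \<Longrightarrow> x' \<in> mspace Y \<Longrightarrow> mdist Y x x' \<le> E"
    using nonempty_compact_metric_bounded[OF Y] by metis
  \<comment> \<open>The route through base points bounds all cross distances, as
    \<open>hausdorff_dist_lessD\<close> requires; \<open>Z\<close> itself may be unbounded.\<close>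
  have bound: "mdist Z a b \<le> D + mdist Z (f x0) (g y0) + E"
    if "a \<in> f ` mspace X" "b \<in> g ` mspace Y" for a b
  proof -
    obtain x y where xy: "x \<in> mspace X" "y \<in> mspace Y" "a = f x" "b = g y" using \<open>a \<in> _\<close> \<open>b \<in> _\<close> by blast
    have "mdist Z (f x) (f x0) \<le> D" "mdist Z (g y0) (g y) \<le> E"
      using f g D E xy x0 y0 by (auto simp: isometric_embedding_def)
    then show ?thesis
      using Z.triangle[of "f x" "f x0" "g y"] Z.triangle[of "f x0" "g y0" "g y"] fZ gZ xy x0 y0 by force
  qed
  define R where "R = {(x, y). x \<in> mspace X \<and> y \<in> mspace Y \<and> mdist Z (f x) (g y) < r}"
  have ne: "f ` mspace X \<noteq> {}" "g ` mspace Y \<noteq> {}" using x0 y0 by auto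
  have "correspondence X Y (2 * r) R"
    unfolding correspondence_def
  proof (intro conjI ballI allI impI)
    show "\<exists>y. (x, y) \<in> R" if "x \<in> mspace X" for x
      using hausdorff_dist_lessD(1)[OF ne bound less, of "f x"] that by (auto simp: R_def)
    show "\<exists>x. (x, y) \<in> R" if "y \<in> mspace Y" for y
      using hausdorff_dist_lessD(2)[OF ne bound less, of "g y"] that by (auto simp: R_def)
    fix x y x' y' assume R: "(x, y) \<in> R" "(x', y') \<in> R"
    then have "f x \<in> mspace Z" "f x' \<in> mspace Z" "g y \<in> mspace Z" "g y' \<in> mspace Z"
      using fZ gZ by (auto simp: R_def)
    then have "\<bar>mdist Z (f x) (f x') - mdist Z (g y) (g y')\<bar> \<le> mdist Z (f x) (g y) + mdist Z (f x') (g y')"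
      using Z.triangle[of "f x" "g y" "f x'"] Z.triangle[of "g y" "g y'" "f x'"]
        Z.triangle[of "g y" "f x" "g y'"] Z.triangle[of "f x" "f x'" "g y'"]
        Z.commute[of "g y" "f x"] Z.commute[of "g y'" "f x'"] by linarith
    then show "\<bar>mdist X x x' - mdist Y y y'\<bar> \<le> 2 * r"
      using f g R by (auto simp: R_def isometric_embedding_def)
  qed (auto simp: R_def)
  then show ?thesis by (auto simp: gh_close_def)
qed

section \<open>The Gromov--Hausdorff distance as half the infimal distortion\<close>

context
  fixes X Y :: "real metric"
  assumes X: "nonempty_compact_metric X" and Y: "nonempty_compact_metric Y"
begin

private abbreviation (input) "dists \<equiv> {hausdorff_dist Z (f ` mspace X) (g ` mspace Y) | (Z :: real metric) f g.
            isometric_embedding X Z f \<and> isometric_embedding Y Z g}"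

private lemma dists_le:
  assumes "gh_close X Y (2 * r)" "0 < r"
  shows "\<exists>h\<in>dists. h \<le> r"
proof -
  obtain Z :: "(real + real) metric" where Z: "isometric_embedding X Z Inl" "isometric_embedding Y Z Inr"
    "hausdorff_dist Z (Inl ` mspace X) (Inr ` mspace Y) \<le> r"
    using glue_along_correspondence[OF assms mspace_nonempty[OF X]] .
  obtain Z' :: "real metric" and f g where "isometric_embedding X Z' f" "isometric_embedding Y Z' g"
    "hausdorff_dist Z' (f ` mspace X) (g ` mspace Y) \<le> r"
    using gromov_hausdorff_ambient_real[OF Z(1,2)] Z(3) by force
  then show ?thesis by blast
qed

private lemma dists_less:
  assumes "h \<in> dists" "h < r"
  shows "gh_close X Y (2 * r)"
  using assms by (auto intro: hausdorff_dist_less_imp_gh_close[OF X Y])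

private lemma dists_nonneg:
  assumes "h \<in> dists"
  shows "0 \<le> h"
proof (rule ccontr)
  assume "\<not> 0 \<le> h"
  \<comment> \<open>A negative \<open>h\<close> lies strictly below \<open>h / 2\<close>, so some
    correspondence would have the negative distortion bound \<open>h\<close>.\<close>
  then have "0 \<le> 2 * (h / 2)"
    by (intro gh_close_nonneg[OF dists_less[OF assms] mspace_nonempty[OF X]]) simp
  with \<open>\<not> 0 \<le> h\<close> show False by simp
qed

private lemma dists_nonempty: "dists \<noteq> {}"
proof -
  obtain r where "0 < r" "gh_close X Y r" using nonempty_compact_imp_gh_close[OF X Y] .
  then show ?thesis using dists_le[of "r / 2"] by auto
qed

lemma gromov_hausdorff_nonneg: "0 \<le> gromov_hausdorff X Y"
  unfolding gromov_hausdorff_def by (rule cInf_greatest[OF dists_nonempty dists_nonneg])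

lemma gromov_hausdorff_le:
  assumes "gh_close X Y (2 * r)" "0 < r"
  shows "gromov_hausdorff X Y \<le> r"
  unfolding gromov_hausdorff_def
  using dists_le[OF assms] by (elim bexE, intro cInf_lower2 bdd_belowI[of _ 0] dists_nonneg)

lemma gromov_hausdorff_lessD:
  assumes "gromov_hausdorff X Y < r"
  shows "gh_close X Y (2 * r)"
proof -
  obtain h where "h \<in> dists" "h < r"
    using cInf_lessD[OF dists_nonempty assms[unfolded gromov_hausdorff_def]] by blast
  then show ?thesis by (rule dists_less)
qed

end

text \<open>Passing to a correspondence needs a strict upper bound, and passing back needs a
  positive radius; the added \<open>e\<close> supplies both.\<close>

lemma gromov_hausdorff_sym_le:
  assumes "nonempty_compact_metric X" "nonempty_compact_metric Y"
  shows "gromov_hausdorff Y X \<le> gromov_hausdorff X Y"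
proof (rule field_le_epsilon)
  fix e :: real assume "0 < e"
  moreover have "0 \<le> gromov_hausdorff X Y" using gromov_hausdorff_nonneg assms .
  ultimately show "gromov_hausdorff Y X \<le> gromov_hausdorff X Y + e"
    using assms by (intro gromov_hausdorff_le gh_close_sym[OF gromov_hausdorff_lessD]) auto
qed

lemma gromov_hausdorff_triangle:
  assumes "nonempty_compact_metric X" "nonempty_compact_metric Y" "nonempty_compact_metric Z"
  shows "gromov_hausdorff X Z \<le> gromov_hausdorff X Y + gromov_hausdorff Y Z"
proof (rule field_le_epsilon)
  fix e :: real assume e: "0 < e"
  let ?a = "gromov_hausdorff X Y + e / 2" and ?b = "gromov_hausdorff Y Z + e / 2"
  have "gh_close X Z (2 * ?a + 2 * ?b)"
    using assms e by (intro gh_close_trans[of X Y _ Z] gromov_hausdorff_lessD) auto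
  then have "gh_close X Z (2 * (?a + ?b))" by (simp add: algebra_simps)
  moreover have "0 \<le> gromov_hausdorff X Y" "0 \<le> gromov_hausdorff Y Z"
    using gromov_hausdorff_nonneg assms by auto
  ultimately have "gromov_hausdorff X Z \<le> ?a + ?b"
    using assms e by (intro gromov_hausdorff_le) auto
  then show "gromov_hausdorff X Z \<le> gromov_hausdorff X Y + gromov_hausdorff Y Z + e" by simp
qed

text \<open>
  Approximate inverses \<open>f\<close> and \<open>g\<close> satisfy \<open>d(f x, y) = d(x, g y)\<close> up to a small error; this
  single condition survives the limit taken by Tychonoff's theorem, and an exact solution of it
  is an isometry.
\<close>

lemma gh_close_imp_isometric:
  assumes X: "nonempty_compact_metric X" and Y: "nonempty_compact_metric Y"
    and close: "\<And>e. 0 < e \<Longrightarrow> gh_close X Y e"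
  shows "isometric X Y"
proof -
  interpret X: Metric_space "mspace X" "mdist X" by simp
  interpret Y: Metric_space "mspace Y" "mdist Y" by simp
  let ?T = "prod_topology (product_topology (\<lambda>_. mtopology_of Y) (mspace X))
                          (product_topology (\<lambda>_. mtopology_of X) (mspace Y))"
  define d where "d = (\<lambda>p x y. \<bar>mdist Y (fst p x) y - mdist X x (snd p y)\<bar> :: real)"
  define C where "C = (\<lambda>n::nat. {p \<in> topspace ?T. \<forall>(x, y)\<in>mspace X \<times> mspace Y. d p x y \<le> 1 / real (Suc n)})"
  have "compact_space ?T"
    using X Y by (auto simp: compact_space_prod_topology compact_space_product_topology nonempty_compact_metric_def)
  moreover have "closedin ?T (C n)" for n
  proof -
    have "closedin ?T {p \<in> topspace ?T. d p x y \<in> {..1 / real (Suc n)}}"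
      if xy: "x \<in> mspace X" "y \<in> mspace Y" for x y
    proof (rule closedin_continuous_map_preimage)
      have "continuous_map ?T (mtopology_of Y) (\<lambda>p. fst p x)"
        using continuous_map_compose[OF continuous_map_fst continuous_map_product_projection[OF xy(1)]]
        by (simp add: comp_def)
      moreover have "continuous_map ?T (mtopology_of X) (\<lambda>p. snd p y)"
        using continuous_map_compose[OF continuous_map_snd continuous_map_product_projection[OF xy(2)]]
        by (simp add: comp_def)
      ultimately have "continuous_map ?T euclideanreal (\<lambda>p. mdist Y (fst p x) y)"
         "continuous_map ?T euclideanreal (\<lambda>p. mdist X x (snd p y))"
        using xy by (auto intro!: continuous_map_mdist)
      then show "continuous_map ?T euclideanreal (\<lambda>p. d p x y)"
        unfolding d_def by (intro continuous_map_real_abs continuous_map_diff)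
    qed simp
    then have "closedin ?T (\<Inter>q\<in>mspace X \<times> mspace Y. {p \<in> topspace ?T. d p (fst q) (snd q) \<in> {..1 / real (Suc n)}})"
      using mspace_nonempty[OF X] mspace_nonempty[OF Y] by (intro closedin_INT) auto
    also have "(\<Inter>q\<in>mspace X \<times> mspace Y. {p \<in> topspace ?T. d p (fst q) (snd q) \<in> {..1 / real (Suc n)}}) = C n"
      using mspace_nonempty[OF X] mspace_nonempty[OF Y] by (auto simp: C_def)
    finally show ?thesis .
  qed
  moreover have "C n \<noteq> {}" for n
  proof -
    obtain R where R: "\<And>x y. (x, y) \<in> R \<Longrightarrow> x \<in> mspace X \<and> y \<in> mspace Y"
      and RX: "\<And>x. x \<in> mspace X \<Longrightarrow> \<exists>y. (x, y) \<in> R" and RY: "\<And>y. y \<in> mspace Y \<Longrightarrow> \<exists>x. (x, y) \<in> R"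
      and dis: "\<And>x y x' y'. (x, y) \<in> R \<Longrightarrow> (x', y') \<in> R \<Longrightarrow> \<bar>mdist X x x' - mdist Y y y'\<bar> \<le> 1 / real (Suc n)"
      using gh_closeE[OF close[of "1 / real (Suc n)"]] by (metis of_nat_0_less_iff zero_less_Suc zero_less_divide_1_iff)
    obtain f where f: "\<And>x. x \<in> mspace X \<Longrightarrow> (x, f x) \<in> R" using RX by metis
    obtain g where g: "\<And>y. y \<in> mspace Y \<Longrightarrow> (g y, y) \<in> R" using RY by metis
    \<comment> \<open>Both \<open>(x, f x)\<close> and \<open>(g y, y)\<close> lie in
      \<open>R\<close>, so its distortion bounds \<open>d\<close>. Restriction makes the maps
      extensional, as points of a product topology are.\<close>
    have "(restrict f (mspace X), restrict g (mspace Y)) \<in> C n"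
      using f g R dis[OF f g] by (auto simp: C_def d_def abs_minus_commute)
    then show ?thesis by blast
  qed
  moreover have "decseq C"
  proof (rule decseq_SucI)
    fix n
    have "1 / real (Suc (Suc n)) \<le> 1 / real (Suc n)" by (simp add: frac_le)
    then show "C (Suc n) \<subseteq> C n" unfolding C_def by (auto intro: order_trans)
  qed
  ultimately have "(\<Inter>n. C n) \<noteq> {}" by (intro compact_space_imp_nest) auto
  then obtain p where p: "\<And>n. p \<in> C n" by blast
  define f where "f = fst p"
  define g where "g = snd p"
  have fY: "f x \<in> mspace Y" if "x \<in> mspace X" for x
    using p[of 0] that by (auto simp: C_def f_def)
  have gX: "g y \<in> mspace X" if "y \<in> mspace Y" for y
    using p[of 0] that by (auto simp: C_def g_def)
  have eq: "mdist Y (f x) y = mdist X x (g y)" if "x \<in> mspace X" "y \<in> mspace Y" for x y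
  proof -
    have "d p x y \<le> 1 / real (Suc n)" for n using p[of n] that by (auto simp: C_def)
    then have "d p x y \<le> 0" by (meson nat_approx_posE not_le)
    then show ?thesis by (simp add: d_def f_def g_def)
  qed
  \<comment> \<open>Substituting \<open>x = g y\<close> in \<open>eq\<close> makes its right side
    zero; substituting \<open>y = f x\<close> does the same for the left side.\<close>
  have fg: "f (g y) = y" if "y \<in> mspace Y" for y
    using eq[OF gX[OF that] that] fY[OF gX[OF that]] gX[OF that] that by simp
  have gf: "g (f x) = x" if "x \<in> mspace X" for x
    using eq[OF that fY[OF that]] gX[OF fY[OF that]] fY[OF that] that by simp
  have "isometric_embedding X Y f"
    using fY eq[OF _ fY] gf by (auto simp: isometric_embedding_def)
  moreover have "f ` mspace X = mspace Y"
    using fY gX fg by (metis (no_types, lifting) image_subset_iff subsetI subset_antisym image_eqI)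
  ultimately show ?thesis by (auto simp: isometric_def)
qed

section \<open>The topology of the Gromov--Hausdorff space\<close>

lemma gh_rel_rep: "gh_rel (rep_gh_space x) (rep_gh_space x)"
  by (rule Quotient3_rep_reflp[OF Quotient3_gh_space])

lemma nonempty_compact_metric_rep [simp]: "nonempty_compact_metric (rep_gh_space x)"
  using gh_rel_rep by (simp add: gh_rel_def)

lemma gh_dist_rep: "gh_dist x y = gromov_hausdorff (rep_gh_space x) (rep_gh_space y)"
  by (simp add: gh_dist_def)

lemma isometric_rep_imp_eq: "isometric (rep_gh_space x) (rep_gh_space y) \<Longrightarrow> x = y"
  using Quotient3_rel_rep[OF Quotient3_gh_space, of x y] by (simp add: gh_rel_def)

lemma isometric_rep_abs: "nonempty_compact_metric X \<Longrightarrow> isometric X (rep_gh_space (abs_gh_space X))"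
  using rep_abs_rsp[OF Quotient3_gh_space, of X X] by (simp add: gh_rel_def isometric_refl)

text \<open>Separation is the substantial axiom: distance zero gives correspondences of arbitrarily
  small distortion, which compactness turns into an isometry.\<close>

lemma Metric_space_gh_dist: "Metric_space UNIV gh_dist"
proof
  fix x y z :: gh_space
  show "0 \<le> gh_dist x y" by (simp add: gh_dist_rep gromov_hausdorff_nonneg)
  show "gh_dist x y = gh_dist y x" by (simp add: gh_dist_rep antisym gromov_hausdorff_sym_le)
  show "gh_dist x z \<le> gh_dist x y + gh_dist y z" by (simp add: gh_dist_rep gromov_hausdorff_triangle)
  show "gh_dist x y = 0 \<longleftrightarrow> x = y"
  proof
    assume 0: "gh_dist x y = 0"
    have "gh_close (rep_gh_space x) (rep_gh_space y) e" if "0 < e" for e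
      using gromov_hausdorff_lessD[of "rep_gh_space x" "rep_gh_space y" "e / 2"] 0 that by (simp add: gh_dist_rep)
    then show "x = y" by (intro isometric_rep_imp_eq gh_close_imp_isometric) auto
  next
    assume "x = y"
    have "gromov_hausdorff (rep_gh_space x) (rep_gh_space x) \<le> e" if "0 < e" for e
      using that by (intro gromov_hausdorff_le gh_close_mono[OF isometric_imp_gh_close[OF isometric_refl]]) auto
    then have "gromov_hausdorff (rep_gh_space x) (rep_gh_space x) \<le> 0"
      by (metis add_0 field_le_epsilon)
    then show "gh_dist x y = 0"
      using \<open>x = y\<close> by (simp add: gh_dist_rep antisym gromov_hausdorff_nonneg)
  qed
qed

interpretation GH: Metric_space UNIV gh_dist
  rewrites "Metric_space.mtopology UNIV gh_dist = gh_topology"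
  by (rule Metric_space_gh_dist) (simp add: gh_topology_def)

lemma gh_dist_lessD: "gh_dist x y < r \<Longrightarrow> gh_close (rep_gh_space x) (rep_gh_space y) (2 * r)"
  by (simp add: gh_dist_rep gromov_hausdorff_lessD)

text \<open>Closedness becomes stability of \<open>P\<close> under limits of correspondences, with
  the topology eliminated. By contraposition, an error bound \<open>e\<close> that excludes
  \<open>P\<close> excludes it on the ball of radius \<open>e / 2\<close>.\<close>

lemma closedin_gh_topologyI:
  assumes "\<And>X. nonempty_compact_metric X \<Longrightarrow> (\<And>e. 0 < e \<Longrightarrow> \<exists>Y :: real metric. gh_close X Y e \<and> P Y) \<Longrightarrow> P X"
  shows "closedin gh_topology {x. P (rep_gh_space x)}"
  unfolding GH.closedin_metric
proof (intro conjI allI impI)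
  fix x assume "x \<in> UNIV - {x. P (rep_gh_space x)}"
  then obtain e where e: "0 < e" "\<And>Y :: real metric. gh_close (rep_gh_space x) Y e \<Longrightarrow> \<not> P Y"
    using assms[of "rep_gh_space x"] by auto
  then have "\<not> P (rep_gh_space y)" if "gh_dist x y < e / 2" for y
    using gh_dist_lessD[OF that] by simp
  then show "\<exists>r>0. disjnt {x. P (rep_gh_space x)} (GH.mball x r)"
    using e(1) by (intro exI[of _ "e / 2"]) (auto simp: disjnt_iff)
qed simp

text \<open>A closed set equals its closure, so it is nowhere dense once every ball contains a point
  outside it. In \<open>codense\<close> that point may depend on \<open>n\<close>.\<close>

lemma dense_fsigma_meager_gh_topologyI:
  assumes S: "S = {x. \<exists>n::nat. C n (rep_gh_space x)}"
    and closed: "\<And>n. closedin gh_topology {x. C n (rep_gh_space x)}"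
    and dense: "\<And>x e. 0 < e \<Longrightarrow> \<exists>y. gh_dist x y < e \<and> y \<in> S"
    and codense: "\<And>n x e. 0 < e \<Longrightarrow> \<exists>y. gh_dist x y < e \<and> \<not> C n (rep_gh_space y)"
  shows "dense_in gh_topology S \<and> fsigma_in gh_topology S \<and> meager_in gh_topology S"
proof (intro conjI)
  have eq: "S = \<Union>(range (\<lambda>n. {x. C n (rep_gh_space x)}))" using S by auto
  have "x \<in> gh_topology closure_of S" for x
    unfolding GH.metric_closure_of using dense[of _ x] by force
  then show "dense_in gh_topology S" by (auto simp: dense_in_def)
  show "fsigma_in gh_topology S"
    unfolding eq by (rule fsigma_in_Union) (auto intro!: closed_imp_fsigma_in closed)
  have "gh_topology interior_of {x. C n (rep_gh_space x)} = {}" for n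
  proof (rule ccontr)
    assume "gh_topology interior_of {x. C n (rep_gh_space x)} \<noteq> {}"
    then obtain x r where "0 < r" "GH.mball x r \<subseteq> {x. C n (rep_gh_space x)}"
      unfolding GH.metric_interior_of by blast
    then show False using codense[of r x n] by auto
  qed
  then have "nowhere_dense_in gh_topology {x. C n (rep_gh_space x)}" for n
    by (simp add: nowhere_dense_in_def closure_of_closedin[OF closed])
  then show "meager_in gh_topology S"
    unfolding meager_in_def eq by (intro countable_union_of_UN countable_union_of_inc) auto
qed

section \<open>Doubling spaces\<close>

text \<open>
  The slack \<open>e\<close> makes the condition closed under Gromov--Hausdorff limits; removing it only costs
  replacing \<open>N\<close> by \<open>N\<^sup>2\<close>.
\<close>

definition almost_doubling :: "nat \<Rightarrow> 'a metric \<Rightarrow> bool" where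
  "almost_doubling N X \<longleftrightarrow>
     (\<forall>x\<in>mspace X. \<forall>r>0. \<forall>e>0. \<exists>F\<subseteq>mspace X. finite F \<and> card F \<le> N \<and>
        (\<forall>z\<in>mspace X. mdist X x z \<le> r \<longrightarrow> (\<exists>y\<in>F. mdist X y z \<le> r / 2 + e)))"

lemma almost_doublingD:
  assumes "almost_doubling N X" "x \<in> mspace X" "0 < r" "0 < e"
  shows "\<exists>F. F \<subseteq> mspace X \<and> finite F \<and> card F \<le> N \<and>
     (\<forall>z\<in>mspace X. mdist X x z \<le> r \<longrightarrow> (\<exists>y\<in>F. mdist X y z \<le> r / 2 + e))"
  using assms unfolding almost_doubling_def by simp

lemma N_doubling_imp_almost_doubling:
  assumes "N_doubling N X"
  shows "almost_doubling N X"
  unfolding almost_doubling_def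
proof (intro ballI allI impI)
  fix x and r e :: real assume x: "x \<in> mspace X" and "0 < r" "0 < e"
  then obtain F where "F \<subseteq> mspace X" "finite F" "card F \<le> N"
    and F: "mcball_of X x r \<subseteq> (\<Union>y\<in>F. mcball_of X y (r / 2))"
    using assms unfolding N_doubling_def by meson
  moreover have "\<exists>y\<in>F. mdist X y z \<le> r / 2 + e" if "z \<in> mspace X" "mdist X x z \<le> r" for z
  proof -
    have "z \<in> mcball_of X x r" using that x by auto
    then obtain y where "y \<in> F" "mdist X y z \<le> r / 2" using F by auto
    then show ?thesis using \<open>0 < e\<close> by force
  qed
  ultimately show "\<exists>F\<subseteq>mspace X. finite F \<and> card F \<le> N \<and>
      (\<forall>z\<in>mspace X. mdist X x z \<le> r \<longrightarrow> (\<exists>y\<in>F. mdist X y z \<le> r / 2 + e))"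
    by blast
qed

lemma almost_doubling_imp_N_doubling:
  assumes "almost_doubling N X"
  shows "N_doubling (N * N) X"
  unfolding N_doubling_def
proof (intro ballI allI impI)
  fix x and r :: real assume x: "x \<in> mspace X" and r: "0 < r"
  \<comment> \<open>Two coverings with these slacks end exactly at half the radius:
    \<open>r / 2 + r / 4 = 3 * r / 4\<close>, and then
    \<open>3 * r / 8 + r / 8 = r / 2\<close>.\<close>
  obtain F where F: "F \<subseteq> mspace X" "finite F" "card F \<le> N"
    "\<And>z. z \<in> mspace X \<Longrightarrow> mdist X x z \<le> r \<Longrightarrow> \<exists>y\<in>F. mdist X y z \<le> r / 2 + r / 4"
    using almost_doublingD[OF assms x r, of "r / 4"] r by auto
  have "\<forall>y\<in>F. \<exists>G. G \<subseteq> mspace X \<and> finite G \<and> card G \<le> N \<and>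
      (\<forall>z\<in>mspace X. mdist X y z \<le> r / 2 + r / 4 \<longrightarrow> (\<exists>w\<in>G. mdist X w z \<le> (r / 2 + r / 4) / 2 + r / 8))"
    using F(1) r by (intro ballI almost_doublingD[OF assms]) auto
  then obtain G where G: "\<And>y. y \<in> F \<Longrightarrow> G y \<subseteq> mspace X \<and> finite (G y) \<and> card (G y) \<le> N \<and>
      (\<forall>z\<in>mspace X. mdist X y z \<le> r / 2 + r / 4 \<longrightarrow> (\<exists>w\<in>G y. mdist X w z \<le> (r / 2 + r / 4) / 2 + r / 8))"
    by metis
  have "card (\<Union>y\<in>F. G y) \<le> (\<Sum>y\<in>F. card (G y))" by (rule card_UN_le[OF F(2)])
  also have "\<dots> \<le> (\<Sum>y\<in>F. N)" using G by (intro sum_mono) auto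
  also have "\<dots> \<le> N * N" using F(3) by simp
  finally have "card (\<Union>y\<in>F. G y) \<le> N * N" .
  moreover have "mcball_of X x r \<subseteq> (\<Union>w\<in>(\<Union>y\<in>F. G y). mcball_of X w (r / 2))"
  proof
    fix z assume "z \<in> mcball_of X x r"
    then have z: "z \<in> mspace X" "mdist X x z \<le> r" by auto
    then obtain y where y: "y \<in> F" "mdist X y z \<le> r / 2 + r / 4" using F(4) by blast
    then obtain w where w: "w \<in> G y" "mdist X w z \<le> (r / 2 + r / 4) / 2 + r / 8" using G z(1) by blast
    then have "mdist X w z \<le> r / 2" "w \<in> mspace X" using G[OF y(1)] by (auto simp: field_simps)
    then have "z \<in> mcball_of X w (r / 2)" using z by simp
    then show "z \<in> (\<Union>w\<in>(\<Union>y\<in>F. G y). mcball_of X w (r / 2))" using w(1) y(1) by blast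
  qed
  ultimately show "\<exists>F\<subseteq>mspace X. mcball_of X x r \<subseteq> (\<Union>y\<in>F. mcball_of X y (r / 2)) \<and>
      finite F \<and> card F \<le> N * N"
    using F(2) G by (intro exI[of _ "\<Union>y\<in>F. G y"]) auto
qed

lemma doubling_iff_almost_doubling: "doubling X \<longleftrightarrow> (\<exists>N. almost_doubling N X)"
  unfolding doubling_def
  using N_doubling_imp_almost_doubling almost_doubling_imp_N_doubling by blast

lemma almost_doubling_limit:
  fixes X :: "'a metric"
  assumes close: "\<And>e. 0 < e \<Longrightarrow> \<exists>Y :: 'b metric. gh_close X Y e \<and> almost_doubling N Y"
  shows "almost_doubling N X"
  unfolding almost_doubling_def
proof (intro ballI allI impI)
  fix x and r e :: real assume x: "x \<in> mspace X" and r: "0 < r" and e: "0 < e"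
  \<comment> \<open>The errors sum to \<open>5 / 2 * \<eta>\<close>: half of the enlargement of the
    radius in \<open>Y\<close>, the slack there, and the distortion on the way back.\<close>
  define \<eta> where "\<eta> = e / 4"
  have \<eta>: "0 < \<eta>" using e by (simp add: \<eta>_def)
  obtain Y :: "'b metric" where Y: "gh_close X Y \<eta>" "almost_doubling N Y" using close[OF \<eta>] by blast
  obtain R where R: "\<And>x y. (x, y) \<in> R \<Longrightarrow> x \<in> mspace X \<and> y \<in> mspace Y"
    and RX: "\<And>x. x \<in> mspace X \<Longrightarrow> \<exists>y. (x, y) \<in> R" and RY: "\<And>y. y \<in> mspace Y \<Longrightarrow> \<exists>x. (x, y) \<in> R"
    and dis: "\<And>x y x' y'. (x, y) \<in> R \<Longrightarrow> (x', y') \<in> R \<Longrightarrow> \<bar>mdist X x x' - mdist Y y y'\<bar> \<le> \<eta>"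
    using gh_closeE[OF Y(1)] by metis
  obtain g where g: "\<And>y. y \<in> mspace Y \<Longrightarrow> (g y, y) \<in> R" using RY by metis
  obtain y where y: "(x, y) \<in> R" using RX x by blast
  have "0 < r + \<eta>" using r \<eta> by simp
  then obtain F where F: "F \<subseteq> mspace Y" "finite F" "card F \<le> N"
    "\<And>z. z \<in> mspace Y \<Longrightarrow> mdist Y y z \<le> r + \<eta> \<Longrightarrow> \<exists>v\<in>F. mdist Y v z \<le> (r + \<eta>) / 2 + \<eta>"
    using almost_doublingD[OF Y(2) _ _ \<eta>, of y "r + \<eta>"] R[OF y] by auto
  have "\<exists>u\<in>g ` F. mdist X u z \<le> r / 2 + e" if z: "z \<in> mspace X" "mdist X x z \<le> r" for z
  proof -
    obtain w where w: "(z, w) \<in> R" using RX z by blast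
    have "mdist Y y w \<le> r + \<eta>" using dis[OF y w] z by linarith
    then obtain v where v: "v \<in> F" "mdist Y v w \<le> (r + \<eta>) / 2 + \<eta>" using F(4) R[OF w] by blast
    then have "mdist X (g v) z \<le> (r + \<eta>) / 2 + \<eta> + \<eta>" using dis[OF g w, of v] F(1) by force
    also have "\<dots> \<le> r / 2 + e" using e by (simp add: \<eta>_def field_simps)
    finally show ?thesis using v(1) by blast
  qed
  moreover have "card (g ` F) \<le> N" using card_image_le[OF F(2), of g] F(3) by linarith
  moreover have "g ` F \<subseteq> mspace X" using g R F(1) by blast
  ultimately show "\<exists>F\<subseteq>mspace X. finite F \<and> card F \<le> N \<and>
      (\<forall>z\<in>mspace X. mdist X x z \<le> r \<longrightarrow> (\<exists>y\<in>F. mdist X y z \<le> r / 2 + e))"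
    using F(2) by (intro exI[of _ "g ` F"]) auto
qed

section \<open>Uniformly disconnected spaces\<close>

text \<open>If the endpoints agree, the left side is zero and any link will do; otherwise the
  sequence is non-constant. So non-constancy can be traded for \<open>2 \<le> N\<close>, and the
  maximum for a single link.\<close>

lemma delta_uniformly_disconnected_iff:
  "delta_uniformly_disconnected \<delta> X \<longleftrightarrow>
     (\<forall>N::nat\<ge>2. \<forall>z. (\<forall>i\<in>{1..N}. z i \<in> mspace X) \<longrightarrow>
        (\<exists>i\<in>{1..<N}. \<delta> * mdist X (z 1) (z N) \<le> mdist X (z i) (z (i + 1))))"
    (is "?L \<longleftrightarrow> ?R")
proof
  have Max: "c \<le> Max (f ` {1..N - 1}) \<longleftrightarrow> (\<exists>i\<in>{1..<N}. c \<le> f i)" if "N \<ge> 2"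
    for c :: real and f and N :: nat
  proof -
    have "{1..N - 1} = {1..<N}" using that by auto
    then show ?thesis using that by (subst Max_ge_iff) auto
  qed
  show ?R if L: ?L
  proof (intro allI impI)
    fix N :: nat and z assume N: "2 \<le> N" and z: "\<forall>i\<in>{1..N}. z i \<in> mspace X"
    show "\<exists>i\<in>{1..<N}. \<delta> * mdist X (z 1) (z N) \<le> mdist X (z i) (z (i + 1))"
    proof (cases "z 1 = z N")
      case True
      moreover have "mdist X (z N) (z N) = 0" using N z by simp
      ultimately show ?thesis using N by (intro bexI[of _ 1]) auto
    next
      case False
      then have "\<exists>i\<in>{1..N}. \<exists>j\<in>{1..N}. z i \<noteq> z j"
        using N by (intro bexI[of _ 1] bexI[of _ N]) auto
      then have "\<delta> * mdist X (z 1) (z N) \<le> (MAX i\<in>{1..N - 1}. mdist X (z i) (z (i + 1)))"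
        using L[unfolded delta_uniformly_disconnected_def, rule_format, of N z] z by simp
      then show ?thesis unfolding Max[OF N] .
    qed
  qed
  show ?L if R: ?R
    unfolding delta_uniformly_disconnected_def
  proof (intro allI impI)
    fix N :: nat and z assume z: "\<forall>i\<in>{1..N}. z i \<in> mspace X"
      and "\<exists>i\<in>{1..N}. \<exists>j\<in>{1..N}. z i \<noteq> z j"
    then obtain i j where ij: "i \<in> {1..N}" "j \<in> {1..N}" "i \<noteq> j" by blast
    then have "2 \<le> N" by auto
    then show "\<delta> * mdist X (z 1) (z N) \<le> (MAX i\<in>{1..N - 1}. mdist X (z i) (z (i + 1)))"
      unfolding Max[OF \<open>2 \<le> N\<close>] using R[rule_format, of N z] z by simp
  qed
qed

lemma delta_uniformly_disconnected_mono:
  assumes "delta_uniformly_disconnected \<delta> X" "\<delta>' \<le> \<delta>"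
  shows "delta_uniformly_disconnected \<delta>' X"
proof -
  have "\<delta>' * mdist X x y \<le> \<delta> * mdist X x y" for x y
    using assms(2) by (simp add: mult_right_mono)
  then show ?thesis
    using assms(1) unfolding delta_uniformly_disconnected_iff by (meson order_trans)
qed

lemma uniformly_disconnected_iff:
  "uniformly_disconnected X \<longleftrightarrow> (\<exists>n. delta_uniformly_disconnected (1 / real (Suc n)) X)"
proof
  assume "uniformly_disconnected X"
  then obtain \<delta> where "0 < \<delta>" "delta_uniformly_disconnected \<delta> X" by (auto simp: uniformly_disconnected_def)
  moreover then obtain n where "1 / real (Suc n) < \<delta>" by (metis nat_approx_posE)
  ultimately show "\<exists>n. delta_uniformly_disconnected (1 / real (Suc n)) X"
    using delta_uniformly_disconnected_mono less_imp_le by blast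
next
  assume "\<exists>n. delta_uniformly_disconnected (1 / real (Suc n)) X"
  then obtain n where "delta_uniformly_disconnected (1 / real (Suc n)) X" ..
  moreover have "0 < 1 / real (Suc n)" by simp
  ultimately show "uniformly_disconnected X"
    unfolding uniformly_disconnected_def by blast
qed

text \<open>The link found in \<open>Y\<close> may change with the error, so it is first bounded by
  the longest link \<open>M\<close> in \<open>X\<close>; the error can then tend to zero.\<close>

lemma delta_uniformly_disconnected_limit:
  fixes X :: "'a metric"
  assumes \<delta>: "0 < \<delta>"
    and close: "\<And>e. 0 < e \<Longrightarrow> \<exists>Y :: 'b metric. gh_close X Y e \<and> delta_uniformly_disconnected \<delta> Y"
  shows "delta_uniformly_disconnected \<delta> X"
  unfolding delta_uniformly_disconnected_iff
proof (intro allI impI)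
  fix N :: nat and z assume N: "2 \<le> N" and z: "\<forall>i\<in>{1..N}. z i \<in> mspace X"
  define M where "M = (MAX i\<in>{1..<N}. mdist X (z i) (z (i + 1)))"
  have fin: "finite ((\<lambda>i. mdist X (z i) (z (i + 1))) ` {1..<N})" "(\<lambda>i. mdist X (z i) (z (i + 1))) ` {1..<N} \<noteq> {}"
    using N by auto
  have "\<delta> * mdist X (z 1) (z N) \<le> M"
  proof (rule field_le_epsilon)
    fix e :: real assume "0 < e"
    \<comment> \<open>The link contributes one \<open>\<eta>\<close>, and the end-to-end distance,
      scaled by \<open>\<delta>\<close>, contributes \<open>\<delta> * \<eta>\<close>.\<close>
    define \<eta> where "\<eta> = e / (1 + \<delta>)"
    have \<eta>: "0 < \<eta>" using \<open>0 < e\<close> \<delta> by (simp add: \<eta>_def)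
    have "\<eta> * (1 + \<delta>) = e" using \<delta> by (simp add: \<eta>_def)
    then have e: "e = \<eta> + \<delta> * \<eta>" by (simp add: algebra_simps)
    obtain Y :: "'b metric" where Y: "gh_close X Y \<eta>" "delta_uniformly_disconnected \<delta> Y" using close[OF \<eta>] by blast
    obtain R where R: "\<And>x y. (x, y) \<in> R \<Longrightarrow> x \<in> mspace X \<and> y \<in> mspace Y"
      and RX: "\<And>x. x \<in> mspace X \<Longrightarrow> \<exists>y. (x, y) \<in> R"
      and dis: "\<And>x y x' y'. (x, y) \<in> R \<Longrightarrow> (x', y') \<in> R \<Longrightarrow> \<bar>mdist X x x' - mdist Y y y'\<bar> \<le> \<eta>"
      using gh_closeE[OF Y(1)] by metis
    obtain f where f: "\<And>x. x \<in> mspace X \<Longrightarrow> (x, f x) \<in> R" using RX by metis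
    then have zR: "(z i, f (z i)) \<in> R" if "i \<in> {1..N}" for i using z that by blast
    then have "\<forall>i\<in>{1..N}. f (z i) \<in> mspace Y" using R by blast
    then obtain i where i: "i \<in> {1..<N}" "\<delta> * mdist Y (f (z 1)) (f (z N)) \<le> mdist Y (f (z i)) (f (z (i + 1)))"
      using Y(2)[unfolded delta_uniformly_disconnected_iff, rule_format, OF N, of "f \<circ> z"] by auto
    have "mdist X (z 1) (z N) \<le> mdist Y (f (z 1)) (f (z N)) + \<eta>"
      using dis[OF zR zR, of 1 N] N by simp
    then have "\<delta> * mdist X (z 1) (z N) \<le> \<delta> * (mdist Y (f (z 1)) (f (z N)) + \<eta>)"
      using \<delta> by (simp add: mult_left_mono)
    also have "\<dots> \<le> mdist Y (f (z i)) (f (z (i + 1))) + \<delta> * \<eta>" using i(2) by (simp add: algebra_simps)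
    also have "\<dots> \<le> mdist X (z i) (z (i + 1)) + \<eta> + \<delta> * \<eta>"
      using dis[OF zR zR, of i "i + 1"] i(1) by simp
    also have "\<dots> \<le> M + e"
      using i(1) fin e unfolding M_def by (simp add: Max_ge)
    finally show "\<delta> * mdist X (z 1) (z N) \<le> M + e" .
  qed
  then show "\<exists>i\<in>{1..<N}. \<delta> * mdist X (z 1) (z N) \<le> mdist X (z i) (z (i + 1))"
    unfolding M_def Max_ge_iff[OF fin] by simp
qed

section \<open>Uniformly perfect spaces\<close>

text \<open>The pair \<open>a\<close>, \<open>b\<close> expresses that \<open>r\<close> is below the
  diameter. This premise is strict and hence survives small errors, while \<open>e\<close> absorbs
  them in the conclusion.\<close>

definition almost_perfect :: "real \<Rightarrow> 'a metric \<Rightarrow> bool" where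
  "almost_perfect c X \<longleftrightarrow>
     (\<forall>x\<in>mspace X. \<forall>r>0. \<forall>e>0. (\<exists>a\<in>mspace X. \<exists>b\<in>mspace X. r < mdist X a b) \<longrightarrow>
        (\<exists>y\<in>mspace X. c * r - e \<le> mdist X x y \<and> mdist X x y \<le> r + e))"

lemma almost_perfectD:
  assumes "almost_perfect c X" "x \<in> mspace X" "0 < r" "0 < e"
    and "a \<in> mspace X" "b \<in> mspace X" "r < mdist X a b"
  shows "\<exists>y\<in>mspace X. c * r - e \<le> mdist X x y \<and> mdist X x y \<le> r + e"
  using assms unfolding almost_perfect_def by blast

lemma less_mdiameter_iff: "ereal r < mdiameter X \<longleftrightarrow> (\<exists>a\<in>mspace X. \<exists>b\<in>mspace X. r < mdist X a b)"
  by (simp add: mdiameter_def less_SUP_iff)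

lemma c_uniformly_perfect_imp_almost_perfect:
  assumes "c_uniformly_perfect c X" "c' \<le> c"
  shows "almost_perfect c' X"
  unfolding almost_perfect_def
proof (intro ballI allI impI)
  fix x and r e :: real assume "x \<in> mspace X" "0 < r" "0 < e" "\<exists>a\<in>mspace X. \<exists>b\<in>mspace X. r < mdist X a b"
  then obtain y where y: "y \<in> mspace X" "c * r \<le> mdist X x y" "mdist X x y \<le> r"
    using assms(1) unfolding c_uniformly_perfect_def less_mdiameter_iff by meson
  moreover have "c' * r \<le> c * r" using assms(2) \<open>0 < r\<close> by simp
  ultimately show "\<exists>y\<in>mspace X. c' * r - e \<le> mdist X x y \<and> mdist X x y \<le> r + e"
    using \<open>0 < e\<close> by (intro bexI[of _ y]) auto
qed

text \<open>Shrinking the radius by a quarter makes room for the slack.\<close>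

lemma almost_perfect_imp_c_uniformly_perfect:
  assumes "almost_perfect c X" "0 < c" "c < 1"
  shows "c_uniformly_perfect (c / 2) X"
  unfolding c_uniformly_perfect_def less_mdiameter_iff
proof (intro ballI allI impI)
  fix x and r :: real assume x: "x \<in> mspace X" and "0 < r \<and> (\<exists>a\<in>mspace X. \<exists>b\<in>mspace X. r < mdist X a b)"
  then obtain a b where r: "0 < r" and ab: "a \<in> mspace X" "b \<in> mspace X" "3 / 4 * r < mdist X a b" by force
  have "0 < 3 / 4 * r" "0 < c * r / 4" using r assms(2) by auto
  then obtain y where y: "y \<in> mspace X" "c * (3 / 4 * r) - c * r / 4 \<le> mdist X x y" "mdist X x y \<le> 3 / 4 * r + c * r / 4"
    using assms(1) x ab unfolding almost_perfect_def by meson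
  moreover have "c * r \<le> r" using r assms(3) by simp
  ultimately show "\<exists>y\<in>mspace X. c / 2 * r \<le> mdist X x y \<and> mdist X x y \<le> r"
    by (intro bexI[of _ y]) auto
qed

text \<open>The double successor keeps the constant strictly below one for every
  \<open>n\<close>.\<close>

lemma uniformly_perfect_iff:
  "uniformly_perfect X \<longleftrightarrow> (\<exists>n. almost_perfect (1 / real (Suc (Suc n))) X)"
proof
  assume "uniformly_perfect X"
  then obtain c where c: "0 < c" "c < 1" "c_uniformly_perfect c X" by (auto simp: uniformly_perfect_def)
  then obtain n where "1 / real (Suc n) < c" by (metis nat_approx_posE)
  moreover have "1 / real (Suc (Suc n)) \<le> 1 / real (Suc n)" by (simp add: frac_le)
  ultimately have "1 / real (Suc (Suc n)) \<le> c" by linarith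
  then show "\<exists>n. almost_perfect (1 / real (Suc (Suc n))) X"
    using c_uniformly_perfect_imp_almost_perfect[OF c(3)] by blast
next
  assume "\<exists>n. almost_perfect (1 / real (Suc (Suc n))) X"
  then obtain n where n: "almost_perfect (1 / real (Suc (Suc n))) X" ..
  let ?c = "1 / real (Suc (Suc n))"
  have "0 < ?c / 2" "?c / 2 < 1" by simp_all
  moreover have "c_uniformly_perfect (?c / 2) X"
    by (rule almost_perfect_imp_c_uniformly_perfect[OF n]) simp_all
  ultimately show "uniformly_perfect X"
    unfolding uniformly_perfect_def by blast
qed

lemma almost_perfect_limit:
  fixes X :: "'a metric"
  assumes close: "\<And>e. 0 < e \<Longrightarrow> \<exists>Y :: 'b metric. gh_close X Y e \<and> almost_perfect c Y"
  shows "almost_perfect c X"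
  unfolding almost_perfect_def
proof (intro ballI allI impI)
  fix x and r e :: real assume x: "x \<in> mspace X" and r: "0 < r" and e: "0 < e"
    and "\<exists>a\<in>mspace X. \<exists>b\<in>mspace X. r < mdist X a b"
  then obtain a b where ab: "a \<in> mspace X" "b \<in> mspace X" "r < mdist X a b" by blast
  \<comment> \<open>The second bound keeps the partners of \<open>a\<close> and \<open>b\<close>
    more than \<open>r\<close> apart, so \<open>r\<close> is still below the diameter of
    \<open>Y\<close>.\<close>
  define \<eta> where "\<eta> = min (e / 2) ((mdist X a b - r) / 2)"
  have \<eta>: "0 < \<eta>" "\<eta> \<le> e / 2" "\<eta> < mdist X a b - r" using e ab by (auto simp: \<eta>_def min_def)
  obtain Y :: "'b metric" where Y: "gh_close X Y \<eta>" "almost_perfect c Y" using close[OF \<eta>(1)] by blast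
  obtain R where R: "\<And>x y. (x, y) \<in> R \<Longrightarrow> x \<in> mspace X \<and> y \<in> mspace Y"
    and RX: "\<And>x. x \<in> mspace X \<Longrightarrow> \<exists>y. (x, y) \<in> R" and RY: "\<And>y. y \<in> mspace Y \<Longrightarrow> \<exists>x. (x, y) \<in> R"
    and dis: "\<And>x y x' y'. (x, y) \<in> R \<Longrightarrow> (x', y') \<in> R \<Longrightarrow> \<bar>mdist X x x' - mdist Y y y'\<bar> \<le> \<eta>"
    using gh_closeE[OF Y(1)] by metis
  obtain x' a' b' where x': "(x, x') \<in> R" and a': "(a, a') \<in> R" and b': "(b, b') \<in> R"
    using RX x ab by metis
  have "r < mdist Y a' b'" using dis[OF a' b'] \<eta> by linarith
  then obtain y' where y': "y' \<in> mspace Y" "c * r - e / 2 \<le> mdist Y x' y'" "mdist Y x' y' \<le> r + e / 2"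
    using almost_perfectD[OF Y(2), of x' r "e / 2" a' b'] R[OF x'] R[OF a'] R[OF b'] r e by auto
  then obtain y where y: "(y, y') \<in> R" using RY by blast
  have "c * r - e \<le> mdist X x y" "mdist X x y \<le> r + e" using dis[OF x' y] y' \<eta>(2) by auto
  then show "\<exists>y\<in>mspace X. c * r - e \<le> mdist X x y \<and> mdist X x y \<le> r + e" using R[OF y] by blast
qed

section \<open>Products of a finite net with a small space\<close>

lemma finite_net:
  assumes "nonempty_compact_metric X" "0 < e"
  obtains A where "finite A" "A \<subseteq> mspace X" "A \<noteq> {}" "\<And>x. x \<in> mspace X \<Longrightarrow> \<exists>a\<in>A. mdist X x a < e"
proof -
  interpret X: Metric_space "mspace X" "mdist X" by simp
  have "compact_space X.mtopology"
    using assms(1) by (simp add: nonempty_compact_metric_def mtopology_of_def)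
  then have "X.mtotally_bounded (mspace X)"
    using X.compact_space_eq_mcomplete_mtotally_bounded by blast
  then obtain A where A: "finite A" "A \<subseteq> mspace X" "mspace X \<subseteq> (\<Union>a\<in>A. X.mball a e)"
    using assms(2) by (auto simp: X.mtotally_bounded_def)
  have "\<exists>a\<in>A. mdist X x a < e" if x: "x \<in> mspace X" for x
  proof -
    obtain a where "a \<in> A" "x \<in> X.mball a e" using subsetD[OF A(3) x] by (elim UN_E)
    then show ?thesis by (intro bexI[of _ a]) (simp_all add: X.commute)
  qed
  moreover have "A \<noteq> {}" using A(3) mspace_nonempty[OF assms(1)] by auto
  ultimately show thesis using that A by blast
qed

lemma finite_imp_nonempty_compact_metric:
  assumes "finite (mspace X)" "mspace X \<noteq> {}"
  shows "nonempty_compact_metric X"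
  using assms finite_imp_compactin[of "mspace X" "mtopology_of X"]
  by (simp add: nonempty_compact_metric_def compact_space_def)

lemma nonempty_compact_prod_metric:
  assumes "nonempty_compact_metric X" "nonempty_compact_metric Y"
  shows "nonempty_compact_metric (prod_metric X Y)"
  using assms by (simp add: nonempty_compact_metric_def mtopology_of_prod_metric compact_space_prod_topology)

text \<open>\<open>prod_metric\<close> is the Euclidean combination of the coordinates. The
  estimates below only use that it lies between each coordinate distance and their sum, and is exact
  on fibres.\<close>

lemma mdist_prod_metric_ge:
  "mdist X (fst p) (fst q) \<le> mdist (prod_metric X Y) p q"
  "mdist Y (snd p) (snd q) \<le> mdist (prod_metric X Y) p q"
  using Metric_space12.component_le_prod_metric[OF Metric_space12_mspace_mdist[of X Y], where ?x1.0 = "fst p" and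
      ?x2.0 = "fst q" and ?y1.0 = "snd p" and ?y2.0 = "snd q"]
  by simp_all

lemma mdist_prod_metric_le:
  assumes "p \<in> mspace (prod_metric X Y)" "q \<in> mspace (prod_metric X Y)"
  shows "mdist (prod_metric X Y) p q \<le> mdist X (fst p) (fst q) + mdist Y (snd p) (snd q)"
  using assms Metric_space12.prod_metric_le_components[OF Metric_space12_mspace_mdist, of "fst p" X "fst q" "snd p" Y "snd q"]
  by auto

lemma mdist_prod_metric_fiber:
  assumes "x \<in> mspace X"
  shows "mdist (prod_metric X Y) (x, y) (x, y') = mdist Y y y'"
proof -
  interpret X: Metric_space "mspace X" "mdist X" by simp
  show ?thesis using assms by (simp add: prod_dist_def)
qed

text \<open>Moving both ends to the net costs at most \<open>2 * e\<close> and the fibre coordinate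
  at most \<open>e\<close>; half of this distortion is below \<open>2 * e\<close>. The product is
  returned up to isometry because its points are pairs, not reals.\<close>

lemma ex_near_product:
  fixes x :: gh_space and K :: "'k metric"
  assumes e: "0 < e" and K: "nonempty_compact_metric K"
    and diam: "\<And>k k'. k \<in> mspace K \<Longrightarrow> k' \<in> mspace K \<Longrightarrow> mdist K k k' \<le> e"
  obtains F :: "real metric" and y where "finite (mspace F)" "mspace F \<noteq> {}"
    "gh_dist x y < 2 * e" "isometric (prod_metric F K) (rep_gh_space y)"
proof -
  define X where "X = rep_gh_space x"
  interpret X: Metric_space "mspace X" "mdist X" by simp
  have X: "nonempty_compact_metric X" by (simp add: X_def)
  obtain A where A: "finite A" "A \<subseteq> mspace X" "A \<noteq> {}" "\<And>x. x \<in> mspace X \<Longrightarrow> \<exists>a\<in>A. mdist X x a < e"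
    using finite_net[OF X e] by metis
  define F where "F = submetric X A"
  have F: "mspace F = A" "mdist F = mdist X"
    using A(2) by (auto simp: F_def)
  define P where "P = prod_metric F K"
  have P: "nonempty_compact_metric P"
    unfolding P_def using A F by (intro nonempty_compact_prod_metric finite_imp_nonempty_compact_metric K) auto
  define R where "R = {(u, p). u \<in> mspace X \<and> p \<in> mspace P \<and> mdist X u (fst p) < e}"
  have "correspondence X P (3 * e) R"
    unfolding correspondence_def
  proof (intro conjI ballI allI impI)
    show "\<exists>p. (u, p) \<in> R" if "u \<in> mspace X" for u
      using A(4)[OF that] mspace_nonempty[OF K] that F by (fastforce simp: R_def P_def)
    show "\<exists>u. (u, p) \<in> R" if "p \<in> mspace P" for p
      using that A(2) F e by (intro exI[of _ "fst p"]) (auto simp: R_def P_def)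
    fix u p v q assume R: "(u, p) \<in> R" "(v, q) \<in> R"
    then have mem: "u \<in> mspace X" "v \<in> mspace X" "fst p \<in> mspace X" "fst q \<in> mspace X" "snd p \<in> mspace K" "snd q \<in> mspace K"
        "p \<in> mspace P" "q \<in> mspace P"
      using A(2) F by (auto simp: R_def P_def)
    have "mdist X u (fst p) < e" "mdist X v (fst q) < e"
      using R by (auto simp: R_def)
    moreover have "mdist X u v \<le> mdist X u (fst p) + mdist X (fst p) (fst q) + mdist X v (fst q)"
      using X.triangle[of u "fst p" v] X.triangle[of "fst p" "fst q" v] X.commute[of v "fst q"] mem by simp
    moreover have "mdist X (fst p) (fst q) \<le> mdist X u (fst p) + mdist X u v + mdist X v (fst q)"
      using X.triangle[of "fst p" u "fst q"] X.triangle[of u v "fst q"] X.commute[of u "fst p"] mem by simp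
    moreover have "mdist X (fst p) (fst q) \<le> mdist P p q" "mdist P p q \<le> mdist X (fst p) (fst q) + mdist K (snd p) (snd q)"
      using mdist_prod_metric_ge(1)[of F p q K] mdist_prod_metric_le[of p F K q] mem F by (auto simp: P_def)
    moreover have "mdist K (snd p) (snd q) \<le> e" using diam mem by blast
    ultimately show "\<bar>mdist X u v - mdist P p q\<bar> \<le> 3 * e" by linarith
  qed (auto simp: R_def)
  then have XP: "gh_close X P (3 * e)" by (auto simp: gh_close_def)
  obtain Y :: "real metric" where Y: "nonempty_compact_metric Y" "isometric P Y"
    using compact_metric_has_real_copy[OF P] by blast
  have iso: "isometric P (rep_gh_space (abs_gh_space Y))"
    using isometric_trans[OF Y(2) isometric_rep_abs[OF Y(1)]] .
  have "gh_close X (rep_gh_space (abs_gh_space Y)) (3 * e + 0)"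
    using gh_close_trans[OF XP isometric_imp_gh_close[OF iso]] .
  then have "gh_close X (rep_gh_space (abs_gh_space Y)) (2 * (3 * e / 2))" by simp
  then have "gh_dist x (abs_gh_space Y) \<le> 3 * e / 2"
    using e X unfolding gh_dist_rep X_def by (intro gromov_hausdorff_le) auto
  then have "gh_dist x (abs_gh_space Y) < 2 * e" using e by simp
  moreover have "finite (mspace F)" "mspace F \<noteq> {}" using A F by auto
  ultimately show thesis using iso that unfolding P_def by blast
qed

section \<open>Finite spaces\<close>

lemma finite_metric_separated:
  assumes "finite (mspace X)"
  obtains m where "0 < m" "\<And>x y. x \<in> mspace X \<Longrightarrow> y \<in> mspace X \<Longrightarrow> x \<noteq> y \<Longrightarrow> m \<le> mdist X x y"
proof -
  interpret X: Metric_space "mspace X" "mdist X" by simp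
  \<comment> \<open>The extra element keeps \<open>Min\<close> meaningful when no two distinct
    points exist.\<close>
  define S where "S = insert 1 ((\<lambda>(x, y). mdist X x y) ` {(x, y) \<in> mspace X \<times> mspace X. x \<noteq> y})"
  have "finite S"
    using assms unfolding S_def by (intro finite.insertI finite_imageI) (auto intro: finite_subset[of _ "mspace X \<times> mspace X"])
  moreover have "0 < s" if "s \<in> S" for s using that by (auto simp: S_def X.mdist_pos_less)
  ultimately have "0 < Min S" by (subst Min_gr_iff) (auto simp: S_def)
  moreover have "Min S \<le> mdist X x y" if "x \<in> mspace X" "y \<in> mspace X" "x \<noteq> y" for x y
    using that \<open>finite S\<close> by (intro Min_le) (auto simp: S_def)
  ultimately show thesis using that by blast
qed

lemma finite_imp_doubling:
  assumes "finite (mspace X)"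
  shows "doubling X"
proof -
  interpret X: Metric_space "mspace X" "mdist X" by simp
  have "N_doubling (card (mspace X)) X"
    unfolding N_doubling_def
  proof (intro ballI allI impI)
    fix x and r :: real assume "0 < r"
    have "mcball_of X x r \<subseteq> (\<Union>y\<in>mspace X. mcball_of X y (r / 2))"
    proof
      fix z assume "z \<in> mcball_of X x r"
      then have "z \<in> mspace X" by simp
      then have "z \<in> mcball_of X z (r / 2)" using \<open>0 < r\<close> by simp
      then show "z \<in> (\<Union>y\<in>mspace X. mcball_of X y (r / 2))" using \<open>z \<in> mspace X\<close> by blast
    qed
    then show "\<exists>F\<subseteq>mspace X. mcball_of X x r \<subseteq> (\<Union>y\<in>F. mcball_of X y (r / 2)) \<and>
        finite F \<and> card F \<le> card (mspace X)"
      using assms by blast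
  qed
  then show ?thesis by (auto simp: doubling_def)
qed

text \<open>A chain either never moves, so its endpoints agree, or has a link of length at least
  \<open>m\<close>, against endpoints at most \<open>D\<close> apart. The denominator
  \<open>\<bar>D\<bar> + 1\<close> is positive whatever bound \<open>D\<close> is obtained.\<close>

lemma finite_imp_uniformly_disconnected:
  assumes "finite (mspace X)"
  shows "uniformly_disconnected X"
proof (cases "mspace X = {}")
  case True
  then have "delta_uniformly_disconnected 1 X"
    by (auto simp: delta_uniformly_disconnected_def)
  then show ?thesis unfolding uniformly_disconnected_def by (intro exI[of _ 1]) auto
next
  case False
  obtain m where m: "0 < m" "\<And>x y. x \<in> mspace X \<Longrightarrow> y \<in> mspace X \<Longrightarrow> x \<noteq> y \<Longrightarrow> m \<le> mdist X x y"
    using finite_metric_separated[OF assms] by metis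
  obtain D where D: "\<And>x y. x \<in> mspace X \<Longrightarrow> y \<in> mspace X \<Longrightarrow> mdist X x y \<le> D"
    using nonempty_compact_metric_bounded[OF finite_imp_nonempty_compact_metric[OF assms False]] by metis
  define \<delta> where "\<delta> = m / (\<bar>D\<bar> + 1)"
  have \<delta>: "0 < \<delta>" using m(1) by (simp add: \<delta>_def)
  have le: "\<delta> * mdist X x y \<le> m" if "x \<in> mspace X" "y \<in> mspace X" for x y
  proof -
    have "\<delta> * mdist X x y \<le> \<delta> * (\<bar>D\<bar> + 1)"
      using D[OF that] \<delta> by (intro mult_left_mono) auto
    also have "\<dots> = m" by (simp add: \<delta>_def)
    finally show ?thesis .
  qed
  have "delta_uniformly_disconnected \<delta> X"
    unfolding delta_uniformly_disconnected_iff
  proof (intro allI impI)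
    fix N :: nat and z assume N: "2 \<le> N" and z: "\<forall>i\<in>{1..N}. z i \<in> mspace X"
    show "\<exists>i\<in>{1..<N}. \<delta> * mdist X (z 1) (z N) \<le> mdist X (z i) (z (i + 1))"
    proof (cases "\<exists>i\<in>{1..<N}. z i \<noteq> z (i + 1)")
      case True
      then obtain i where i: "i \<in> {1..<N}" "z i \<noteq> z (i + 1)" by blast
      then have "m \<le> mdist X (z i) (z (i + 1))" using z by (intro m(2)) auto
      moreover have "\<delta> * mdist X (z 1) (z N) \<le> m" using z N by (intro le) auto
      ultimately show ?thesis using i(1) by force
    next
      case False
      have "z k = z 1" if "1 \<le> k" "k \<le> N" for k
        using that
      proof (induction k rule: dec_induct)
        case (step k)
        then show ?case using False by force
      qed simp
      from this[of N] N have "z N = z 1" by linarith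
      moreover have "mdist X (z 1) (z 1) = 0" using z N by simp
      ultimately show ?thesis using N by (intro bexI[of _ 1]) auto
    qed
  qed
  then show ?thesis using \<delta> by (auto simp: uniformly_disconnected_def)
qed

text \<open>At radius \<open>m / 2\<close> the ball around \<open>a\<close> contains only
  \<open>a\<close>, while \<open>b\<close> shows that this radius is below the diameter.\<close>

lemma finite_imp_not_uniformly_perfect:
  assumes "finite (mspace X)" and ab: "a \<in> mspace X" "b \<in> mspace X" "a \<noteq> b"
  shows "\<not> uniformly_perfect X"
proof
  interpret X: Metric_space "mspace X" "mdist X" by simp
  assume "uniformly_perfect X"
  then obtain c where c: "0 < c" "c_uniformly_perfect c X" by (auto simp: uniformly_perfect_def)
  obtain m where m: "0 < m" "\<And>x y. x \<in> mspace X \<Longrightarrow> y \<in> mspace X \<Longrightarrow> x \<noteq> y \<Longrightarrow> m \<le> mdist X x y"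
    using finite_metric_separated[OF assms(1)] by metis
  have "m / 2 < mdist X a b" using m(1) m(2)[OF ab] by linarith
  then obtain y where y: "y \<in> mspace X" "c * (m / 2) \<le> mdist X a y" "mdist X a y \<le> m / 2"
    using c(2) ab m(1) unfolding c_uniformly_perfect_def less_mdiameter_iff by (metis half_gt_zero)
  then have "y = a" using m ab(1) by (metis field_sum_of_halves less_add_same_cancel1 half_gt_zero not_le order_trans)
  moreover have "0 < c * (m / 2)" using c(1) m(1) by simp
  ultimately show False using y ab(1) by simp
qed

section \<open>Products with a finite equilateral space\<close>

definition equilateral_metric :: "real \<Rightarrow> nat \<Rightarrow> nat metric" where
  "equilateral_metric s M = metric ({..M}, \<lambda>i j. if i = j then 0 else s)"

lemma
  assumes "0 < s"
  shows mspace_equilateral: "mspace (equilateral_metric s M) = {..M}"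
    and mdist_equilateral: "mdist (equilateral_metric s M) i j = (if i = j then 0 else s)"
proof -
  interpret E: Metric_space "{..M}" "\<lambda>i j. if i = j then 0 else s"
    by unfold_locales (use assms in \<open>auto split: if_splits\<close>)
  show "mspace (equilateral_metric s M) = {..M}"
    "mdist (equilateral_metric s M) i j = (if i = j then 0 else s)"
    by (simp_all add: equilateral_metric_def)
qed

text \<open>
  A fibre has \<open>M + 1\<close> points at mutual distance \<open>s\<close>, and a ball of radius \<open>3 * s / 4\<close> contains
  at most the fibre point lying over the second coordinate of its centre.
\<close>

lemma prod_equilateral_not_almost_doubling:
  assumes s: "0 < s" and "mspace F \<noteq> {}"
  shows "\<not> almost_doubling M (prod_metric F (equilateral_metric s M))"
proof
  let ?K = "equilateral_metric s M"
  let ?P = "prod_metric F ?K"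
  assume ad: "almost_doubling M ?P"
  obtain a where a: "a \<in> mspace F" using assms(2) by blast
  have K: "mspace ?K = {..M}" by (rule mspace_equilateral[OF s])
  have "(a, 0) \<in> mspace ?P" using a K by simp
  then obtain G where G: "finite G" "card G \<le> M"
    "\<forall>z\<in>mspace ?P. mdist ?P (a, 0) z \<le> s \<longrightarrow> (\<exists>y\<in>G. mdist ?P y z \<le> s / 2 + s / 4)"
    using almost_doublingD[OF ad _ s, of "(a, 0)" "s / 4"] s by auto
  have "{..M} \<subseteq> snd ` G"
  proof
    fix k assume k: "k \<in> {..M}"
    then have "(a, k) \<in> mspace ?P" using a K by simp
    moreover have "mdist ?P (a, 0) (a, k) \<le> s"
      using s by (simp add: mdist_prod_metric_fiber[OF a] mdist_equilateral[OF s] del: mdist_prod_metric)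
    ultimately obtain y where y: "y \<in> G" "mdist ?P y (a, k) \<le> s / 2 + s / 4" using G(3) by blast
    then have "mdist ?K (snd y) k \<le> s / 2 + s / 4"
      using mdist_prod_metric_ge(2)[of ?K y "(a, k)" F] by simp
    then have "snd y = k" using s by (auto simp: mdist_equilateral[OF s] split: if_splits)
    then show "k \<in> snd ` G" using y(1) by blast
  qed
  then have "card {..M} \<le> card (snd ` G)" using G(1) by (intro card_mono) auto
  also have "\<dots> \<le> card G" using G(1) by (rule card_image_le)
  finally show False using G(2) by simp
qed

lemma ex_near_finite:
  fixes x :: gh_space
  assumes "0 < e"
  obtains y where "gh_dist x y < e" "finite (mspace (rep_gh_space y))"
    "\<not> almost_doubling M (rep_gh_space y)" "\<not> uniformly_perfect (rep_gh_space y)"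
proof -
  let ?s = "e / 2"
  \<comment> \<open>\<open>Suc M\<close> rather than \<open>M\<close> guarantees two distinct points
    even for \<open>M = 0\<close>, which the failure of uniform perfectness needs.\<close>
  let ?K = "equilateral_metric ?s (Suc M)"
  have s: "0 < ?s" using assms by simp
  have K: "mspace ?K = {..Suc M}" by (rule mspace_equilateral[OF s])
  have "nonempty_compact_metric ?K" by (rule finite_imp_nonempty_compact_metric) (auto simp: K)
  then obtain F :: "real metric" and y where F: "finite (mspace F)" "mspace F \<noteq> {}"
    and y: "gh_dist x y < 2 * ?s" "isometric (prod_metric F ?K) (rep_gh_space y)"
    by (rule ex_near_product[OF s, of ?K x]) (use s in \<open>auto simp: mdist_equilateral[OF s]\<close>)
  let ?Y = "rep_gh_space y"
  obtain f where f: "isometric_embedding (prod_metric F ?K) ?Y f" "f ` mspace (prod_metric F ?K) = mspace ?Y"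
    using y(2) by (auto simp: isometric_def)
  have fin: "finite (mspace ?Y)"
    using F(1) K by (simp add: f(2)[symmetric])
  obtain a where a: "a \<in> mspace F" using F(2) by blast
  have "f (a, 0) \<noteq> f (a, 1)"
    using isometric_embedding_inj[OF f(1)] a K by (auto simp: inj_on_def)
  moreover have "f (a, 0) \<in> mspace ?Y" "f (a, 1) \<in> mspace ?Y"
    using a K by (auto simp: f(2)[symmetric])
  ultimately have "\<not> uniformly_perfect ?Y"
    using finite_imp_not_uniformly_perfect[OF fin] by blast
  moreover have "\<not> almost_doubling M ?Y"
  proof
    assume "almost_doubling M ?Y"
    then have "almost_doubling (Suc M) ?Y"
      unfolding almost_doubling_def by (meson le_SucI)
    \<comment> \<open>Isometric spaces are close for every error, so stability under limits also
      transports the property along an isometry.\<close>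
    then have "almost_doubling (Suc M) (prod_metric F ?K)"
      using gh_close_mono[OF isometric_imp_gh_close[OF y(2)]] less_imp_le
      by (intro almost_doubling_limit) blast
    then show False using prod_equilateral_not_almost_doubling[OF s F(2)] by blast
  qed
  ultimately show thesis using that y(1) fin by simp
qed

section \<open>Products with an interval\<close>

definition interval_metric :: "real \<Rightarrow> real metric" where
  "interval_metric e = submetric euclidean_metric {0..e}"

lemma mspace_interval [simp]: "mspace (interval_metric e) = {0..e}"
  by (simp add: interval_metric_def)

lemma mdist_interval [simp]: "mdist (interval_metric e) s t = \<bar>s - t\<bar>"
  by (simp add: interval_metric_def dist_real_def)

lemma nonempty_compact_interval: "0 \<le> e \<Longrightarrow> nonempty_compact_metric (interval_metric e)"
  by (simp add: nonempty_compact_metric_def interval_metric_def mtopology_of_submetric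
      compact_space_subtopology)

text \<open>Equally spaced points cross a fibre of length \<open>e\<close> in \<open>Suc n\<close>
  steps, which would force \<open>\<delta> \<le> 1 / real (Suc n)\<close>.\<close>

lemma prod_interval_not_uniformly_disconnected:
  assumes e: "0 < e" and "mspace F \<noteq> {}"
  shows "\<not> uniformly_disconnected (prod_metric F (interval_metric e))"
proof
  let ?P = "prod_metric F (interval_metric e)"
  assume "uniformly_disconnected ?P"
  then obtain \<delta> where \<delta>: "0 < \<delta>" "delta_uniformly_disconnected \<delta> ?P"
    by (auto simp: uniformly_disconnected_def)
  obtain a where a: "a \<in> mspace F" using assms(2) by blast
  obtain n where n: "1 / real (Suc n) < \<delta>" using nat_approx_posE[OF \<delta>(1)] .
  define h where "h = e / real (Suc n)"
  have h: "0 < h" "real (Suc n) * h = e" using e by (simp_all add: h_def)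
  \<comment> \<open>Chains are indexed from 1, hence the shift; \<open>n + 2\<close> points make
    \<open>Suc n\<close> links.\<close>
  define z where "z = (\<lambda>i. (a, real (i - 1) * h))"
  have dz: "mdist ?P (z i) (z j) = \<bar>real (i - 1) * h - real (j - 1) * h\<bar>" for i j
    unfolding z_def by (simp add: mdist_prod_metric_fiber[OF a] del: mdist_prod_metric)
  have "z i \<in> mspace ?P" if "i \<in> {1..n + 2}" for i
  proof -
    have "real (i - 1) * h \<le> real (Suc n) * h" using that h(1) by (intro mult_right_mono) auto
    then have "real (i - 1) * h \<le> e" unfolding h(2) .
    then show ?thesis using a h(1) by (simp add: z_def)
  qed
  then obtain i where i: "i \<in> {1..<n + 2}" "\<delta> * mdist ?P (z 1) (z (n + 2)) \<le> mdist ?P (z i) (z (i + 1))"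
    using \<delta>(2)[unfolded delta_uniformly_disconnected_iff, rule_format, of "n + 2" z] by auto
  have "mdist ?P (z 1) (z (n + 2)) = e"
    using e h(2) unfolding dz by simp
  moreover have "mdist ?P (z i) (z (i + 1)) = h"
  proof -
    obtain j where "i = Suc j" using i(1) by (cases i) auto
    then show ?thesis using h(1) unfolding dz by (simp add: algebra_simps)
  qed
  ultimately have "\<delta> * e \<le> 1 / real (Suc n) * e" using i(2) by (simp add: h_def)
  then have "\<delta> \<le> 1 / real (Suc n)" using e by (simp only: mult_le_cancel_right_pos)
  then show False using n by simp
qed

text \<open>The required point is found by moving inside the fibre. This works directly for radii up
  to \<open>e\<close>; larger relevant radii are at most \<open>D\<close>, so a move by
  \<open>e / 2\<close> is still a fixed fraction of them.\<close>

lemma prod_interval_uniformly_perfect: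
  assumes e: "0 < e" and F: "nonempty_compact_metric F"
  shows "uniformly_perfect (prod_metric F (interval_metric e))"
proof -
  let ?P = "prod_metric F (interval_metric e)"
  obtain D where D: "\<And>p q. p \<in> mspace ?P \<Longrightarrow> q \<in> mspace ?P \<Longrightarrow> mdist ?P p q \<le> D"
    using nonempty_compact_metric_bounded[OF nonempty_compact_prod_metric[OF F nonempty_compact_interval]] e
    by (metis less_imp_le)
  \<comment> \<open>This choice gives \<open>c * r \<le> e / 2\<close> for \<open>r \<le> D\<close>,
    and the maximum ensures \<open>c \<le> 1 / 2\<close>, which handles
    \<open>r \<le> e\<close>.\<close>
  define c where "c = e / (2 * max D e)"
  have c: "0 < c" "c \<le> 1 / 2" using e by (auto simp: c_def field_simps max_def)
  have "c_uniformly_perfect c ?P"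
    unfolding c_uniformly_perfect_def less_mdiameter_iff
  proof (intro ballI allI impI)
    fix p and r :: real assume p: "p \<in> mspace ?P" and "0 < r \<and> (\<exists>a\<in>mspace ?P. \<exists>b\<in>mspace ?P. r < mdist ?P a b)"
    then have r: "0 < r" "r \<le> D" using D by force+
    obtain a t where p_eq: "p = (a, t)" by (cases p)
    then have a: "a \<in> mspace F" and t: "0 \<le> t" "t \<le> e" using p by auto
    define u where "u = min r e / 2"
    have u: "0 < u" "u \<le> r" "u \<le> e / 2" using r e by (auto simp: u_def)
    \<comment> \<open>Moving away from the nearer end leaves room for \<open>u\<close>, which is at
      most \<open>e / 2\<close>.\<close>
    define s where "s = (if t \<le> e / 2 then t + u else t - u)"
    have s: "0 \<le> s" "s \<le> e" "\<bar>t - s\<bar> = u" using u t by (auto simp: s_def)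
    have "c * r \<le> u"
    proof (cases "r \<le> e")
      case True
      have "c * r \<le> 1 / 2 * r" using c(2) r(1) by (intro mult_right_mono) auto
      then show ?thesis using True by (simp add: u_def)
    next
      case False
      have "c * r \<le> c * max D e" using c(1) r(2) by (intro mult_left_mono) auto
      also have "\<dots> = e / 2" using e by (simp add: c_def)
      finally show ?thesis using False by (simp add: u_def)
    qed
    moreover have "mdist ?P p (a, s) = u"
      using s(3) by (simp add: p_eq mdist_prod_metric_fiber[OF a] del: mdist_prod_metric)
    moreover have "(a, s) \<in> mspace ?P" using a s by simp
    ultimately show "\<exists>y\<in>mspace ?P. c * r \<le> mdist ?P p y \<and> mdist ?P p y \<le> r"
      using u(2) by (intro bexI[of _ "(a, s)"]) auto
  qed
  then show ?thesis using c by (auto simp: uniformly_perfect_def intro!: exI[of _ c])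
qed

lemma ex_near_perfect:
  fixes x :: gh_space
  assumes "0 < e"
  obtains y where "gh_dist x y < e" "uniformly_perfect (rep_gh_space y)"
    "\<not> uniformly_disconnected (rep_gh_space y)"
proof -
  let ?K = "interval_metric (e / 2)"
  have s: "0 < e / 2" using assms by simp
  have diam: "mdist ?K k k' \<le> e / 2" if "k \<in> mspace ?K" "k' \<in> mspace ?K" for k k'
    using that unfolding mspace_interval mdist_interval atLeastAtMost_iff by linarith
  obtain F :: "real metric" and y where F: "finite (mspace F)" "mspace F \<noteq> {}"
    and y: "gh_dist x y < 2 * (e / 2)" "isometric (prod_metric F ?K) (rep_gh_space y)"
    by (rule ex_near_product[OF s nonempty_compact_interval[of "e / 2"], OF _ diam, where x = x]) (use s in auto)
  have "uniformly_perfect (rep_gh_space y)"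
    using prod_interval_uniformly_perfect[OF s finite_imp_nonempty_compact_metric[OF F]]
      c_uniformly_perfect_isometric[OF y(2)] unfolding uniformly_perfect_def by blast
  moreover have "\<not> uniformly_disconnected (rep_gh_space y)"
    using prod_interval_not_uniformly_disconnected[OF s F(2)]
      delta_uniformly_disconnected_isometric[OF isometric_sym[OF y(2)]]
    unfolding uniformly_disconnected_def by blast
  ultimately show thesis using that y(1) by simp
qed

section \<open>The three classes in terms of representatives, and the conclusion\<close>

lemma mem_DO: "x \<in> DO \<longleftrightarrow> doubling (rep_gh_space x)"
  by (simp add: DO_def doubling_class_def)

lemma mem_UD: "x \<in> UD \<longleftrightarrow> uniformly_disconnected (rep_gh_space x)"
  by (simp add: UD_def uniformly_disconnected_class_def)

lemma mem_UP: "x \<in> UP \<longleftrightarrow> uniformly_perfect (rep_gh_space x)"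
  by (simp add: UP_def uniformly_perfect_class_def)

theorem theorem1p1:
  shows "(dense_in gh_topology DO \<and> fsigma_in gh_topology DO \<and> meager_in gh_topology DO) \<and>
         (dense_in gh_topology UD \<and> fsigma_in gh_topology UD \<and> meager_in gh_topology UD) \<and>
         (dense_in gh_topology UP \<and> fsigma_in gh_topology UP \<and> meager_in gh_topology UP)"
proof (intro conjI[of "dense_in _ DO \<and> _"] conjI[of "dense_in _ UD \<and> _"])
  show "dense_in gh_topology DO \<and> fsigma_in gh_topology DO \<and> meager_in gh_topology DO"
  proof (rule dense_fsigma_meager_gh_topologyI[where C = almost_doubling])
    show "DO = {x. \<exists>n. almost_doubling n (rep_gh_space x)}"
      by (auto simp: mem_DO doubling_iff_almost_doubling)
    show "closedin gh_topology {x. almost_doubling n (rep_gh_space x)}" for n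
      by (rule closedin_gh_topologyI) (rule almost_doubling_limit)
    show "\<exists>y. gh_dist x y < e \<and> y \<in> DO" if "0 < e" for x e
      using ex_near_finite[OF that] finite_imp_doubling mem_DO by metis
    \<comment> \<open>The witness is adapted to \<open>n\<close>: being finite, it still belongs to
      \<open>DO\<close>.\<close>
    show "\<exists>y. gh_dist x y < e \<and> \<not> almost_doubling n (rep_gh_space y)" if "0 < e" for n x e
      using ex_near_finite[OF that] by metis
  qed
  show "dense_in gh_topology UD \<and> fsigma_in gh_topology UD \<and> meager_in gh_topology UD"
  proof (rule dense_fsigma_meager_gh_topologyI[where C = "\<lambda>n. delta_uniformly_disconnected (1 / real (Suc n))"])
    show "UD = {x. \<exists>n. delta_uniformly_disconnected (1 / real (Suc n)) (rep_gh_space x)}"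
      by (auto simp: mem_UD uniformly_disconnected_iff)
    show "closedin gh_topology {x. delta_uniformly_disconnected (1 / real (Suc n)) (rep_gh_space x)}" for n
      by (rule closedin_gh_topologyI, rule delta_uniformly_disconnected_limit) simp_all
    show "\<exists>y. gh_dist x y < e \<and> y \<in> UD" if "0 < e" for x e
      using ex_near_finite[OF that] finite_imp_uniformly_disconnected mem_UD by metis
    \<comment> \<open>The witness lies outside \<open>UD\<close>, so it violates the condition for
      all \<open>n\<close> at once.\<close>
    show "\<exists>y. gh_dist x y < e \<and> \<not> delta_uniformly_disconnected (1 / real (Suc n)) (rep_gh_space y)"
      if "0 < e" for n x e
      using ex_near_perfect[OF that] uniformly_disconnected_iff by metis
  qed
  show "dense_in gh_topology UP \<and> fsigma_in gh_topology UP \<and> meager_in gh_topology UP"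
  proof (rule dense_fsigma_meager_gh_topologyI[where C = "\<lambda>n. almost_perfect (1 / real (Suc (Suc n)))"])
    show "UP = {x. \<exists>n. almost_perfect (1 / real (Suc (Suc n))) (rep_gh_space x)}"
      by (auto simp: mem_UP uniformly_perfect_iff)
    show "closedin gh_topology {x. almost_perfect (1 / real (Suc (Suc n))) (rep_gh_space x)}" for n
      by (rule closedin_gh_topologyI) (rule almost_perfect_limit)
    show "\<exists>y. gh_dist x y < e \<and> y \<in> UP" if "0 < e" for x e
      using ex_near_perfect[OF that] mem_UP by metis
    show "\<exists>y. gh_dist x y < e \<and> \<not> almost_perfect (1 / real (Suc (Suc n))) (rep_gh_space y)"
      if "0 < e" for n x e
      using ex_near_finite[OF that] uniformly_perfect_iff by metis
  qed
qed

end
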